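(* Let $n\in\mathbb{N}$ and let $T_i:=T_{e_i}$, $i=0,\dots,n$, be the creation operators on the Fock space $F$ of the subproduct system of $\rho_n$ (notation in the context). Then \[\sum_{i=0}^n(-1)^iT_iT_{n-i}=0,\qquad T_i^*T_j=\delta_{ij}1_F+(-1)^{i+j+1}\big((n+1)1_F-\Phi^{-1}\big)T_{n-i}T_{n-j}^*\ \ (i,j\in\{0,\dots,n\}),\qquad \sum_{i=0}^nT_i^*T_i=\Phi^{-1}.\]
   Context: Fix $n\in\mathbb{N}$. Let $f_0,f_1$ be the standard basis of $\mathbb{C}^2$, $L_n\subseteq(\mathbb{C}^2)^{\otimes n}$ the symmetric tensors with orthogonal projection $p_n$, and $\rho_n$ the restriction to $L_n$ of the $n$-fold tensor power of the fundamental representation of $SU(2)$. Let $e_k=\sqrt{n!/(k!(n-k)!)}\,p_n(f_0^{\otimes k}\otimes f_1^{\otimes(n-k)})$ ($k=0,\dots,n$), an orthonormal basis of $L_n$. Let $D_2\subseteq L_n\otimes L_n$ be the subspace of $\rho_n\otimes\rho_n$-invariant vectors, $K_m=\sum_{i=1}^{m-1}L_n^{\otimes(i-1)}\otimes D_2\otimes L_n^{\otimes(m-i-1)}$ and $E_m=K_m^\perp\subseteq L_n^{\otimes m}$ for $m\ge2$, $E_1=L_n$, $E_0=\mathbb{C}$. Let $\iota_{k,m}:E_{k+m}\to E_k\otimes E_m$ be the inclusions induced by $L_n^{\otimes(k+m)}=L_n^{\otimes k}\otimes L_n^{\otimes m}$. The Fock space is $F=\bigoplus_{m\ge0}E_m$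 (Hilbert direct sum); for $\xi\in E_k$ the creation operator $T_\xi\in\mathcal{B}(F)$ is $T_\xi(\zeta)=\iota_{k,m}^*(\xi\otimes\zeta)$ for $\zeta\in E_m$. Define $d_0=1,d_1=n+1$, $d_m=d_1d_{m-1}-d_{m-2}$, and the bounded invertible operator $\Phi$ on $F$ by $\Phi\xi=(d_m/d_{m+1})\xi$ for $\xi\in E_m$. *)

theory Defs
  imports "HOL-Analysis.Analysis"
begin

text \<open>Vectors of (C^2)^{\<otimes>N} are modelled as functions on words over {0,1}
  (False = index of f_0, True = index of f_1), supported on words of length N.
  All spaces L_n^{\<otimes>m} live inside (C^2)^{\<otimes>(n m)}.\<close>

type_synonym vec = "bool list \<Rightarrow> complex"

definition inner_v :: "vec \<Rightarrow> vec \<Rightarrow> complex" where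
  "inner_v x y = infsum (\<lambda>w. x w * cnj (y w)) UNIV"

definition cspan :: "vec set \<Rightarrow> vec set" where
  "cspan S = {x. \<exists>t r. finite t \<and> t \<subseteq> S \<and> x = (\<lambda>w. \<Sum>a\<in>t. r a * a w)}"

definition proj :: "vec set \<Rightarrow> vec \<Rightarrow> vec" where
  "proj V x = (THE y. y \<in> V \<and> (\<forall>z\<in>V. inner_v (\<lambda>w. x w - y w) z = 0))"

text \<open>elementary tensor x \<otimes> y, where x has a tensor factors of C^2\<close>
definition tens :: "nat \<Rightarrow> vec \<Rightarrow> vec \<Rightarrow> vec" where
  "tens a x y = (\<lambda>w. x (take a w) * y (drop a w))"

definition tensor_sp :: "nat \<Rightarrow> vec set \<Rightarrow> vec set \<Rightarrow> vec set" where
  "tensor_sp a A B = cspan {tens a x y | x y. x \<in> A \<and> y \<in> B}"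

definition tens_space :: "nat \<Rightarrow> vec set" where
  "tens_space N = {x. \<forall>w. length w \<noteq> N \<longrightarrow> x w = 0}"

definition Ln :: "nat \<Rightarrow> vec set" where
  "Ln n = {x \<in> tens_space n. \<forall>\<sigma> w. \<sigma> permutes {..<n} \<and> length w = n \<longrightarrow>
              x (map (\<lambda>j. w ! \<sigma> j) [0..<n]) = x w}"

fun tpow :: "nat \<Rightarrow> nat \<Rightarrow> vec set" where
  "tpow n 0 = tens_space 0"
| "tpow n (Suc m) = tensor_sp n (Ln n) (tpow n m)"

text \<open>SU(2), matrices indexed by bool (False ~ f_0, True ~ f_1)\<close>
definition su2 :: "(bool \<Rightarrow> bool \<Rightarrow> complex) \<Rightarrow> bool" where
  "su2 U \<longleftrightarrow> (\<forall>i k. (\<Sum>j\<in>UNIV. U i j * cnj (U k j)) = (if i = k then 1 else 0))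
            \<and> U False False * U True True - U False True * U True False = 1"

definition tpow_op :: "(bool \<Rightarrow> bool \<Rightarrow> complex) \<Rightarrow> nat \<Rightarrow> vec \<Rightarrow> vec" where
  "tpow_op U N x = (\<lambda>w. if length w = N
      then (\<Sum>v\<in>{v::bool list. length v = N}. (\<Prod>j<N. U (w ! j) (v ! j)) * x v) else 0)"

text \<open>D_2: the rho_n \<otimes> rho_n invariant vectors of L_n \<otimes> L_n\<close>
definition D2 :: "nat \<Rightarrow> vec set" where
  "D2 n = {x \<in> tensor_sp n (Ln n) (Ln n). \<forall>U. su2 U \<longrightarrow> tpow_op U (2 * n) x = x}"

definition Ksp :: "nat \<Rightarrow> nat \<Rightarrow> vec set" where
  "Ksp n m = cspan (\<Union>i\<in>{1..m-1}.
      tensor_sp (n * (i - 1)) (tpow n (i - 1)) (tensor_sp (2 * n) (D2 n) (tpow n (m - i - 1))))"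

text \<open>E_m = K_m^\<bottom> inside L_n^{\<otimes>m}; for m = 0,1 K_m = 0, giving E_0 = C, E_1 = L_n\<close>
definition Esp :: "nat \<Rightarrow> nat \<Rightarrow> vec set" where
  "Esp n m = {x \<in> tpow n m. \<forall>y\<in>Ksp n m. inner_v x y = 0}"

definition e :: "nat \<Rightarrow> nat \<Rightarrow> vec" where
  "e n k = (\<lambda>w. complex_of_real (sqrt (fact n / (fact k * fact (n - k))))
       * proj (Ln n) (\<lambda>u. if u = replicate k False @ replicate (n - k) True then 1 else 0) w)"

definition Fock :: "nat \<Rightarrow> (nat \<Rightarrow> vec) set" where
  "Fock n = {v. (\<forall>m. v m \<in> Esp n m) \<and> summable (\<lambda>m. Re (inner_v (v m) (v m)))}"

definition innerF :: "(nat \<Rightarrow> vec) \<Rightarrow> (nat \<Rightarrow> vec) \<Rightarrow> complex" where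
  "innerF v u = (\<Sum>m. inner_v (v m) (u m))"

text \<open>creation operator T_xi for xi in E_1: T_xi zeta = iota_{1,m}^*(xi \<otimes> zeta),
  iota^* being the orthogonal projection onto E_{1+m}\<close>
definition creation :: "nat \<Rightarrow> vec \<Rightarrow> (nat \<Rightarrow> vec) \<Rightarrow> (nat \<Rightarrow> vec)" where
  "creation n \<xi> v = (\<lambda>m. case m of 0 \<Rightarrow> (\<lambda>w. 0)
                       | Suc k \<Rightarrow> proj (Esp n (Suc k)) (tens n \<xi> (v k)))"

definition T :: "nat \<Rightarrow> nat \<Rightarrow> (nat \<Rightarrow> vec) \<Rightarrow> (nat \<Rightarrow> vec)" where
  "T n i = creation n (e n i)"

definition adjF :: "nat \<Rightarrow> ((nat \<Rightarrow> vec) \<Rightarrow> (nat \<Rightarrow> vec)) \<Rightarrow> (nat \<Rightarrow> vec) \<Rightarrow> (nat \<Rightarrow> vec)" where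
  "adjF n S v = (THE u. u \<in> Fock n \<and> (\<forall>z\<in>Fock n. innerF u z = innerF v (S z)))"

fun d :: "nat \<Rightarrow> nat \<Rightarrow> real" where
  "d n 0 = 1"
| "d n (Suc 0) = real n + 1"
| "d n (Suc (Suc m)) = (real n + 1) * d n (Suc m) - d n m"

definition Phi :: "nat \<Rightarrow> (nat \<Rightarrow> vec) \<Rightarrow> (nat \<Rightarrow> vec)" where
  "Phi n v = (\<lambda>m w. complex_of_real (d n m / d n (Suc m)) * v m w)"

definition Phi_inv :: "nat \<Rightarrow> (nat \<Rightarrow> vec) \<Rightarrow> (nat \<Rightarrow> vec)" where
  "Phi_inv n v = (THE u. u \<in> Fock n \<and> Phi n u = v)"

end

(*
  The invariants D_2 are spanned by delta = sum_k (-1)^k e_k (x) e_{n-k}, so E_m consists of the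
  tensors whose contraction with delta vanishes in every pair of adjacent positions, and on E_{m+1}
  the adjoint T_i^* is the contraction c_i of the first factor with e_i.  For zeta in E_m the vector
    y = sum_i e_i (x) (delta_ij zeta - (-1)^(i+j) (d_{m-1}/d_m) T_{n-i} c_{n-j} zeta)
  is the projection of e_j (x) zeta onto E_{m+1}: the difference is orthogonal to E_{m+1} since
  sum_i (-1)^i c_{n-i} c_i = 0 there, and y lies in E_{m+1} because sum_i c_i T_i = d_m/d_{m-1} on
  E_{m-1}.  This is the formula for T_i^* T_j; its trace over i = j, together with
  sum_i T_i c_i = 1 and the recursion for d, carries the last identity from E_{m-1} to E_m.
*)
theory Submission
  imports Defs
begin

section \<open>Words, inner products and spans\<close>

text \<open>\<open>proj\<close>, \<open>adjF\<close> and \<open>Phi_inv\<close> are definite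
  descriptions, so each value has to come from an explicit candidate and a uniqueness argument. That
  e_j (x) zeta has a projection onto E_{m+1} is itself a result of the induction that yields the
  relations. Its parts feed each other: membership of y in E_{m+1} uses the trace relation one level
  below, the inner products of y use adjointness one level below, and the next trace relation uses
  membership and adjointness again. The factor d_{m-1}/d_m is forced: with r in its place the
  delta-contraction of y is (-1)^j (1 - r d_m/d_{m-1}) c_{n-j} zeta. That delta spans D_2 has two
  halves: diagonal matrices and rotations leave at most one invariant up to scalars, and a
  symmetrised power of the two-leg invariant supplies a non-zero one. On each E_m all is
  finite-dimensional. The Fock space enters only through square-summability, for which it suffices
  that T_j and c_j are contractions and that d_{m+1}/d_m is at most n + 1.\<close>

definition words :: "nat \<Rightarrow> bool list set" where
  "words N = {w. length w = N}"

lemma finite_words [simp]: "finite (words N)"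
  using finite_lists_length_eq[of "UNIV :: bool set" N] by (simp add: words_def)

lemma words_0 [simp]: "words 0 = {[]}"
  by (auto simp: words_def)

lemma words_Suc: "words (Suc n) = Cons False ` words n \<union> Cons True ` words n"
  by (auto simp: words_def length_Suc_conv image_iff)

lemma sum_words_Suc:
  fixes f :: "bool list \<Rightarrow> 'a::comm_monoid_add"
  shows "(\<Sum>w\<in>words (Suc n). f w) = (\<Sum>w\<in>words n. f (False # w)) + (\<Sum>w\<in>words n. f (True # w))"
  unfolding words_Suc by (subst sum.union_disjoint) (auto simp: sum.reindex inj_on_def)

lemma sum_words_append:
  fixes f :: "bool list \<Rightarrow> 'a::comm_monoid_add"
  shows "(\<Sum>w\<in>words (a + b). f w) = (\<Sum>u\<in>words a. \<Sum>v\<in>words b. f (u @ v))"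
  by (induction a arbitrary: f) (simp_all add: sum_words_Suc)

lemma sum_prod_words:
  fixes f :: "nat \<Rightarrow> bool \<Rightarrow> 'a::comm_semiring_1"
  shows "(\<Sum>w\<in>words n. \<Prod>j<n. f j (w ! j)) = (\<Prod>j<n. \<Sum>b\<in>UNIV. f j b)"
proof (induction n arbitrary: f)
  case (Suc n)
  show ?case
    using Suc[of "\<lambda>j. f (Suc j)"]
    by (simp add: sum_words_Suc prod.lessThan_Suc_shift UNIV_bool algebra_simps
        del: prod.lessThan_Suc flip: sum_distrib_left)
qed simp

text \<open>Turns entries of a tensor power of a 2x2 matrix, along legs with a constant row letter,
  into monomials governed by letter counts.\<close>

lemma prod_nth_bool:
  fixes f :: "bool \<Rightarrow> 'a::comm_monoid_mult"
  shows "(\<Prod>j<length w. f (w ! j)) = f False ^ count_list w False * f True ^ count_list w True"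
proof (induction w)
  case (Cons b w)
  then show ?case
    by (cases b) (simp_all add: prod.lessThan_Suc_shift mult_ac del: prod.lessThan_Suc)
qed simp

lemma count_list_bool: "count_list w False + count_list w True = length w"
  by (induction w) auto

text \<open>Over two letters, length and one count already fix the orbit under permutations of
  positions, so symmetric tensors become functions of the count.\<close>

lemma mset_eq_bool_iff:
  "mset u = mset w \<longleftrightarrow> length u = length w \<and> count_list u False = count_list w False"
proof
  assume "mset u = mset w"
  then show "length u = length w \<and> count_list u False = count_list w False"
    by (metis mset_eq_length count_mset)
next
  assume *: "length u = length w \<and> count_list u False = count_list w False"
  then have "count_list u True = count_list w True"
    using count_list_bool[of u] count_list_bool[of w] by linarith
  with * have "count_list u b = count_list w b" for b
    by (cases b) auto
  then show "mset u = mset w"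
    by (auto intro!: multiset_eqI simp flip: count_mset)
qed

lemma card_words_count: "card {w \<in> words n. count_list w False = k} = n choose k"
proof (induction n arbitrary: k)
  case 0
  have "{w \<in> words 0. count_list w False = k} = (if k = 0 then {[]} else {})" by auto
  then show ?case by (cases k) auto
next
  case (Suc n)
  have 1: "{w \<in> words (Suc n). count_list w False = k} =
     Cons False ` {w \<in> words n. Suc (count_list w False) = k} \<union>
     Cons True ` {w \<in> words n. count_list w False = k}"
    by (auto simp: words_Suc)
  have "card {w \<in> words (Suc n). count_list w False = k} =
     card {w \<in> words n. Suc (count_list w False) = k} +
     card {w \<in> words n. count_list w False = k}"
    unfolding 1 by (subst card_Un_disjoint) (auto simp: card_image)
  then show ?case by (cases k) (simp_all add: Suc)
qed

lemma count_list_words_le: "w \<in> words n \<Longrightarrow> count_list w False \<le> n"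
  by (auto simp: words_def count_le_length)

lemma sum_words_count:
  fixes f :: "nat \<Rightarrow> complex"
  shows "(\<Sum>w\<in>words n. f (count_list w False)) = (\<Sum>k\<le>n. of_nat (n choose k) * f k)"
proof -
  have "(\<Sum>w\<in>words n. f (count_list w False)) =
      (\<Sum>k\<le>n. \<Sum>w\<in>{w \<in> words n. count_list w False = k}. f (count_list w False))"
    by (rule sum.group[symmetric]) (auto simp: count_list_words_le)
  also have "\<dots> = (\<Sum>k\<le>n. of_nat (n choose k) * f k)"
    by (intro sum.cong refl) (simp add: card_words_count)
  finally show ?thesis .
qed

text \<open>The support of the second argument alone truncates the infinite sum; this lets the
  vector to be projected in \<open>proj_eqI\<close> stay arbitrary.\<close>

lemma inner_words:
  assumes "z \<in> tens_space N"
  shows "inner_v x z = (\<Sum>w\<in>words N. x w * cnj (z w))"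
proof -
  have "inner_v x z = infsum (\<lambda>w. x w * cnj (z w)) (words N)"
    unfolding inner_v_def using assms
    by (intro infsum_cong_neutral) (auto simp: tens_space_def words_def)
  then show ?thesis by simp
qed

definition nsq :: "vec \<Rightarrow> real" where
  "nsq x = Re (inner_v x x)"

lemma nsq_words: "x \<in> tens_space N \<Longrightarrow> nsq x = (\<Sum>w\<in>words N. (cmod (x w))\<^sup>2)"
  by (simp add: nsq_def inner_words complex_mult_cnj cmod_power2)

lemma inner_self_nsq: "x \<in> tens_space N \<Longrightarrow> inner_v x x = of_real (nsq x)"
  by (simp add: nsq_words inner_words complex_norm_square del: of_real_power)

lemma nsq_nonneg: "x \<in> tens_space N \<Longrightarrow> nsq x \<ge> 0"
  by (simp add: nsq_words sum_nonneg)

lemma inner_self_eq_0: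
  assumes "x \<in> tens_space N" "inner_v x x = 0"
  shows "x = (\<lambda>w. 0)"
proof
  fix w
  from assms have "(\<Sum>w\<in>words N. (cmod (x w))\<^sup>2) = 0"
    by (metis inner_self_nsq nsq_words of_real_eq_0_iff)
  then have "\<forall>w\<in>words N. x w = 0" by (subst (asm) sum_nonneg_eq_0_iff) auto
  then show "x w = 0" using assms(1) by (cases "length w = N") (auto simp: words_def tens_space_def)
qed

text \<open>Weaker than Cauchy--Schwarz, but enough to see that creation is a contraction.\<close>
lemma Re_inner_le:
  assumes "x \<in> tens_space N" "y \<in> tens_space N"
  shows "Re (inner_v x y) \<le> (nsq x + nsq y) / 2"
proof -
  have "Re (inner_v x y) = (\<Sum>w\<in>words N. Re (x w * cnj (y w)))"
    using assms by (simp add: inner_words)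
  also have "\<dots> \<le> (\<Sum>w\<in>words N. ((cmod (x w))\<^sup>2 + (cmod (y w))\<^sup>2) / 2)"
  proof (rule sum_mono)
    fix w
    have "Re (x w * cnj (y w)) \<le> cmod (x w) * cmod (y w)"
      by (metis complex_Re_le_cmod complex_mod_cnj norm_mult)
    also have "\<dots> \<le> ((cmod (x w))\<^sup>2 + (cmod (y w))\<^sup>2) / 2"
      using sum_squares_bound[of "cmod (x w)" "cmod (y w)"] by simp
    finally show "Re (x w * cnj (y w)) \<le> ((cmod (x w))\<^sup>2 + (cmod (y w))\<^sup>2) / 2" .
  qed
  also have "\<dots> = (nsq x + nsq y) / 2"
    using assms by (simp add: nsq_words sum.distrib flip: sum_divide_distrib)
  finally show ?thesis .
qed

lemma inner_commute:
  assumes "x \<in> tens_space N" "y \<in> tens_space N"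
  shows "inner_v x y = cnj (inner_v y x)"
  using assms by (simp add: inner_words mult.commute)

lemma inner_sum_left:
  assumes "z \<in> tens_space N"
  shows "inner_v (\<lambda>w. \<Sum>i\<in>I. c i * x i w) z = (\<Sum>i\<in>I. c i * inner_v (x i) z)"
proof -
  have "inner_v (\<lambda>w. \<Sum>i\<in>I. c i * x i w) z = (\<Sum>w\<in>words N. \<Sum>i\<in>I. c i * (x i w * cnj (z w)))"
    using assms by (simp add: inner_words sum_distrib_right mult.assoc)
  also have "\<dots> = (\<Sum>i\<in>I. \<Sum>w\<in>words N. c i * (x i w * cnj (z w)))"
    by (rule sum.swap)
  finally show ?thesis
    using assms by (simp add: inner_words sum_distrib_left)
qed

lemma inner_diff_left:
  assumes "z \<in> tens_space N"
  shows "inner_v (\<lambda>w. x w - y w) z = inner_v x z - inner_v y z"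
  using assms by (simp add: inner_words sum_subtractf algebra_simps)

lemma inner_scale_left:
  assumes "z \<in> tens_space N"
  shows "inner_v (\<lambda>w. c * x w) z = c * inner_v x z"
  using assms by (simp add: inner_words sum_distrib_left mult_ac)

lemma inner_sum_right:
  assumes "\<And>i. i \<in> I \<Longrightarrow> y i \<in> tens_space N"
  shows "inner_v x (\<lambda>w. \<Sum>i\<in>I. c i * y i w) = (\<Sum>i\<in>I. cnj (c i) * inner_v x (y i))"
proof -
  have "(\<lambda>w. \<Sum>i\<in>I. c i * y i w) \<in> tens_space N"
    using assms by (auto simp: tens_space_def intro!: sum.neutral)
  then have "inner_v x (\<lambda>w. \<Sum>i\<in>I. c i * y i w) =
      (\<Sum>w\<in>words N. \<Sum>i\<in>I. cnj (c i) * (x w * cnj (y i w)))"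
    by (simp add: inner_words sum_distrib_left mult_ac)
  also have "\<dots> = (\<Sum>i\<in>I. \<Sum>w\<in>words N. cnj (c i) * (x w * cnj (y i w)))"
    by (rule sum.swap)
  also have "\<dots> = (\<Sum>i\<in>I. cnj (c i) * inner_v x (y i))"
    using assms by (intro sum.cong) (auto simp: inner_words[of _ N] sum_distrib_left)
  finally show ?thesis .
qed

lemma inner_add_left:
  assumes "z \<in> tens_space N"
  shows "inner_v (\<lambda>w. x w + y w) z = inner_v x z + inner_v y z"
  using assms by (simp add: inner_words sum.distrib distrib_right)

lemma inner_scale_right:
  assumes "z \<in> tens_space N"
  shows "inner_v x (\<lambda>w. c * z w) = cnj c * inner_v x z"
  using inner_sum_right[of "{0::nat}" "\<lambda>_. z" N x "\<lambda>_. c"] assms by simp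

section \<open>Subspaces, spans and orthogonal projections\<close>

definition subsp :: "vec set \<Rightarrow> bool" where
  "subsp V \<longleftrightarrow> (\<lambda>w. 0) \<in> V \<and> (\<forall>x\<in>V. \<forall>y\<in>V. (\<lambda>w. x w + y w) \<in> V) \<and>
     (\<forall>c. \<forall>x\<in>V. (\<lambda>w. c * x w) \<in> V)"

lemma subsp_sum:
  assumes "subsp V" "\<And>i. i \<in> I \<Longrightarrow> x i \<in> V"
  shows "(\<lambda>w. \<Sum>i\<in>I. c i * x i w) \<in> V"
  using assms(2)
proof (induction I rule: infinite_finite_induct)
  case (insert i I)
  have "(\<lambda>w. (c i * x i w) + (\<Sum>i\<in>I. c i * x i w)) \<in> V"
    using assms(1) insert by (simp add: subsp_def)
  then show ?case using insert by simp
qed (use assms(1) in \<open>auto simp: subsp_def\<close>)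

lemma subsp_scale: "subsp V \<Longrightarrow> x \<in> V \<Longrightarrow> (\<lambda>w. c * x w) \<in> V"
  by (simp add: subsp_def)

lemma subsp_lincomb:
  assumes "subsp V" "x \<in> V" "y \<in> V"
  shows "(\<lambda>w. a * x w + b * y w) \<in> V"
  using assms by (simp add: subsp_def)

lemma subsp_diff: "subsp V \<Longrightarrow> x \<in> V \<Longrightarrow> y \<in> V \<Longrightarrow> (\<lambda>w. x w - y w) \<in> V"
  using subsp_lincomb[of V x y 1 "-1"] by simp

lemma subsp_tens_space: "subsp (tens_space N)"
  by (auto simp: subsp_def tens_space_def)

lemma cspan_superset: "x \<in> S \<Longrightarrow> x \<in> cspan S"
  unfolding cspan_def by (auto intro!: exI[of _ "{x}"] exI[of _ "\<lambda>_. 1"])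

lemma cspan_minimal:
  assumes "subsp V" "S \<subseteq> V"
  shows "cspan S \<subseteq> V"
proof
  fix x assume "x \<in> cspan S"
  then obtain t r where t: "t \<subseteq> S" "x = (\<lambda>w. \<Sum>a\<in>t. r a * a w)"
    unfolding cspan_def by auto
  then show "x \<in> V"
    using subsp_sum[OF assms(1), of t "\<lambda>a. a" r] assms(2) by auto
qed

lemma subsp_cspan: "subsp (cspan S)"
  unfolding subsp_def
proof (intro conjI ballI allI)
  show "(\<lambda>w. 0) \<in> cspan S"
    unfolding cspan_def by (auto intro!: exI[of _ "{}"])
next
  fix x y assume "x \<in> cspan S" "y \<in> cspan S"
  then obtain t r t' r' where
    t: "finite t" "t \<subseteq> S" "x = (\<lambda>w. \<Sum>a\<in>t. r a * a w)" and
    t': "finite t'" "t' \<subseteq> S" "y = (\<lambda>w. \<Sum>a\<in>t'. r' a * a w)"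
    unfolding cspan_def by blast
  have "x w = (\<Sum>a\<in>t \<union> t'. (if a \<in> t then r a else 0) * a w)" for w
    unfolding t(3) using t(1) t'(1) by (intro sum.mono_neutral_cong_left) auto
  moreover have "y w = (\<Sum>a\<in>t \<union> t'. (if a \<in> t' then r' a else 0) * a w)" for w
    unfolding t'(3) using t(1) t'(1) by (intro sum.mono_neutral_cong_left) auto
  ultimately have "(\<lambda>w. x w + y w) =
      (\<lambda>w. \<Sum>a\<in>t \<union> t'. ((if a \<in> t then r a else 0) + (if a \<in> t' then r' a else 0)) * a w)"
    by (simp add: sum.distrib distrib_right)
  then show "(\<lambda>w. x w + y w) \<in> cspan S"
    unfolding cspan_def using t(1,2) t'(1,2)
    by (intro CollectI exI[of _ "t \<union> t'"]
        exI[of _ "\<lambda>a. (if a \<in> t then r a else 0) + (if a \<in> t' then r' a else 0)"]) auto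
next
  fix c x assume "x \<in> cspan S"
  then obtain t r where t: "finite t" "t \<subseteq> S" "x = (\<lambda>w. \<Sum>a\<in>t. r a * a w)"
    unfolding cspan_def by blast
  then show "(\<lambda>w. c * x w) \<in> cspan S"
    unfolding cspan_def
    by (intro CollectI exI[of _ t] exI[of _ "\<lambda>a. c * r a"]) (auto simp: sum_distrib_left mult_ac)
qed

lemma orthogonal_cspan_iff:
  assumes "S \<subseteq> tens_space N"
  shows "(\<forall>a\<in>cspan S. inner_v x a = 0) \<longleftrightarrow> (\<forall>a\<in>S. inner_v x a = 0)"
proof
  assume *: "\<forall>a\<in>S. inner_v x a = 0"
  show "\<forall>a\<in>cspan S. inner_v x a = 0"
  proof
    fix a assume "a \<in> cspan S"
    then obtain t r where t: "finite t" "t \<subseteq> S" "a = (\<lambda>w. \<Sum>a\<in>t. r a * a w)"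
      unfolding cspan_def by blast
    then show "inner_v x a = 0"
      using inner_sum_right[of t "\<lambda>a. a" N x r] assms * by (auto simp: subset_iff intro!: sum.neutral)
  qed
qed (auto intro: cspan_superset)

text \<open>The difference lies in \<open>V\<close>, so it may be tested against itself. All
  uniqueness arguments for projections and for components in E_m rest on this.\<close>

lemma vec_eqI:
  assumes V: "subsp V" "V \<subseteq> tens_space N" and xy: "x \<in> V" "y \<in> V"
    and "\<And>z. z \<in> V \<Longrightarrow> inner_v x z = inner_v y z"
  shows "x = y"
proof -
  have z: "(\<lambda>w. x w - y w) \<in> V" using subsp_diff[OF V(1) xy] .
  then have zt: "(\<lambda>w. x w - y w) \<in> tens_space N" using V(2) by blast
  have "inner_v (\<lambda>w. x w - y w) (\<lambda>w. x w - y w) = 0"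
    using assms(5)[OF z] by (simp add: inner_diff_left[OF zt])
  from inner_self_eq_0[OF zt this] show "x = y" by (simp add: fun_eq_iff)
qed

text \<open>A given candidate takes the place of an existence theorem; a second candidate would have
  the same inner products with \<open>V\<close>, so \<open>vec_eqI\<close> excludes it.\<close>

lemma proj_eqI:
  assumes "subsp V" "V \<subseteq> tens_space N" "y \<in> V"
    and "\<And>z. z \<in> V \<Longrightarrow> inner_v (\<lambda>w. x w - y w) z = 0"
  shows "proj V x = y"
  unfolding proj_def
proof (rule the_equality)
  fix y' assume y': "y' \<in> V \<and> (\<forall>z\<in>V. inner_v (\<lambda>w. x w - y' w) z = 0)"
  show "y' = y"
  proof (rule vec_eqI[OF assms(1,2) conjunct1[OF y'] assms(3)])
    fix z assume z: "z \<in> V"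
    then have zt: "z \<in> tens_space N" using assms(2) by blast
    show "inner_v y' z = inner_v y z"
      using assms(4)[OF z] bspec[OF conjunct2[OF y'] z] by (simp only: inner_diff_left[OF zt]) simp
  qed
qed (use assms in auto)

section \<open>The orthonormal basis of symmetric tensors\<close>

lemma Ln_iff:
  "x \<in> Ln n \<longleftrightarrow> x \<in> tens_space n \<and>
     (\<forall>u\<in>words n. \<forall>w\<in>words n. count_list u False = count_list w False \<longrightarrow> x u = x w)"
  (is "_ \<longleftrightarrow> _ \<and> ?sym")
proof -
  have "?sym \<longleftrightarrow> (\<forall>\<sigma> w. \<sigma> permutes {..<n} \<and> length w = n \<longrightarrow> x (map (\<lambda>j. w ! \<sigma> j) [0..<n]) = x w)"
  proof (intro iffI allI ballI impI)
    fix \<sigma> and w :: "bool list"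
    assume *: ?sym and \<sigma>: "\<sigma> permutes {..<n} \<and> length w = n"
    then have "mset (permute_list \<sigma> w) = mset w" by (intro mset_permute_list) auto
    with * \<sigma> show "x (map (\<lambda>j. w ! \<sigma> j) [0..<n]) = x w"
      unfolding mset_eq_bool_iff by (auto simp: permute_list_def words_def)
  next
    fix u w :: "bool list"
    assume *: "\<forall>\<sigma> w. \<sigma> permutes {..<n} \<and> length w = n \<longrightarrow> x (map (\<lambda>j. w ! \<sigma> j) [0..<n]) = x w"
      and uw: "u \<in> words n" "w \<in> words n" "count_list u False = count_list w False"
    then have "mset u = mset w" by (auto simp: mset_eq_bool_iff words_def)
    then obtain p where "p permutes {..<length w}" "permute_list p w = u"
      by (rule mset_eq_permutation)
    with *[rule_format, of p w] uw show "x u = x w" by (auto simp: permute_list_def words_def)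
  qed
  then show ?thesis unfolding Ln_def by simp
qed

lemma Ln_tens_space: "x \<in> Ln n \<Longrightarrow> x \<in> tens_space n"
  by (simp add: Ln_iff)

lemma Ln_sym:
  "x \<in> Ln n \<Longrightarrow> u \<in> words n \<Longrightarrow> w \<in> words n \<Longrightarrow> count_list u False = count_list w False \<Longrightarrow> x u = x w"
  unfolding Ln_iff by blast

lemma subsp_Ln: "subsp (Ln n)"
  unfolding subsp_def
proof (intro conjI ballI allI)
    show "(\<lambda>w. 0) \<in> Ln n" by (simp add: Ln_iff tens_space_def)
  next
    fix x y assume xy: "x \<in> Ln n" "y \<in> Ln n"
    then have "(\<lambda>w. x w + y w) \<in> tens_space n" by (simp add: Ln_iff tens_space_def)
    moreover have "x u + y u = x w + y w"
      if "u \<in> words n" "w \<in> words n" "count_list u False = count_list w False" for u w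
      using Ln_sym[OF xy(1) that] Ln_sym[OF xy(2) that] by simp
    ultimately show "(\<lambda>w. x w + y w) \<in> Ln n" unfolding Ln_iff by blast
  next
    fix c x assume x: "x \<in> Ln n"
    then have "(\<lambda>w. c * x w) \<in> tens_space n" by (simp add: Ln_iff tens_space_def)
    moreover have "c * x u = c * x w"
      if "u \<in> words n" "w \<in> words n" "count_list u False = count_list w False" for u w
      using Ln_sym[OF x that] by simp
    ultimately show "(\<lambda>w. c * x w) \<in> Ln n" unfolding Ln_iff by blast
qed

text \<open>Projecting one basis word averages over the \<open>n choose k\<close> words with the
  same count; the prefactor is the square root of this number, which leaves one over its square
  root.\<close>

lemma e_eq:
  assumes "k \<le> n"
  shows "e n k = (\<lambda>w. if length w = n \<and> count_list w False = k
     then of_real (1 / sqrt (n choose k)) else 0)"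
proof -
  define u0 where "u0 = replicate k False @ replicate (n - k) True"
  define y :: vec where "y = (\<lambda>w. if length w = n \<and> count_list w False = k
     then 1 / of_nat (n choose k) else 0)"
  have u0: "length u0 = n" "count_list u0 False = k" "u0 \<in> words n"
    using assms by (auto simp: u0_def words_def simp flip: count_mset)
  have y: "y \<in> Ln n" by (auto simp: Ln_iff y_def tens_space_def words_def)
  have C: "of_nat (n choose k) \<noteq> (0 :: complex)" using assms by simp
  have "proj (Ln n) (\<lambda>u. if u = u0 then 1 else 0) = y"
  proof (rule proj_eqI[OF subsp_Ln _ y, of n])
    fix z assume z: "z \<in> Ln n"
    have zc: "z w = z u0" if "w \<in> words n" "count_list w False = k" for w
      using Ln_sym[OF z that(1) u0(3)] that(2) u0(2) by simp
    have "inner_v y z = (\<Sum>w\<in>{w \<in> words n. count_list w False = k}. 1 / of_nat (n choose k) * cnj (z w))"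
      unfolding inner_words[OF Ln_tens_space[OF z]]
      by (rule sum.mono_neutral_cong_right[OF finite_words]) (auto simp: y_def words_def)
    also have "\<dots> = (\<Sum>w\<in>{w \<in> words n. count_list w False = k}. 1 / of_nat (n choose k) * cnj (z u0))"
    proof (rule sum.cong[OF refl])
      fix w assume "w \<in> {w \<in> words n. count_list w False = k}"
      then have "z w = z u0" using zc by blast
      then show "1 / of_nat (n choose k) * cnj (z w) = 1 / of_nat (n choose k) * cnj (z u0)" by simp
    qed
    also have "\<dots> = cnj (z u0)" using C by (simp add: card_words_count)
    also have "\<dots> = inner_v (\<lambda>u. if u = u0 then 1 else 0) z"
      unfolding inner_words[OF Ln_tens_space[OF z]] using u0(3)
      by (simp add: if_distrib[of "\<lambda>a. a * _"] cong: if_cong)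
    finally show "inner_v (\<lambda>w. (if w = u0 then 1 else 0) - y w) z = 0"
      by (simp add: inner_diff_left[OF Ln_tens_space[OF z]])
  qed (auto simp: Ln_tens_space)
  moreover have "complex_of_real (sqrt (fact n / (fact k * fact (n - k)))) * (1 / of_nat (n choose k))
      = of_real (1 / sqrt (n choose k))"
  proof -
    have "fact n / (fact k * fact (n - k)) = real (n choose k)"
      using assms by (simp add: binomial_fact)
    moreover have "sqrt (n choose k) * (1 / (n choose k)) = 1 / sqrt (n choose k)"
      using assms by (simp add: field_simps)
    ultimately show ?thesis by (metis of_real_mult of_real_divide of_real_1 of_real_of_nat_eq)
  qed
  ultimately show ?thesis unfolding e_def u0_def y_def by (auto simp: fun_eq_iff)
qed

lemma e_cnj: "k \<le> n \<Longrightarrow> cnj (e n k w) = e n k w"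
  by (simp add: e_eq)

lemma e_Ln: "k \<le> n \<Longrightarrow> e n k \<in> Ln n"
  by (auto simp: e_eq Ln_iff tens_space_def words_def)

lemma Ln_expand:
  assumes "x \<in> Ln n"
  shows "x w = (\<Sum>i\<le>n. (\<Sum>u\<in>words n. e n i u * x u) * e n i w)"
proof (cases "w \<in> words n")
  case True
  define k where "k = count_list w False"
  have k: "k \<le> n" using count_list_words_le[OF True] by (simp add: k_def)
  then have C: "complex_of_real (sqrt (n choose k)) \<noteq> 0"
     "complex_of_real (sqrt (n choose k)) * complex_of_real (sqrt (n choose k)) = of_nat (n choose k)"
    by (auto simp flip: of_real_mult)
  have "(\<Sum>u\<in>words n. e n k u * x u) = (\<Sum>u\<in>{u \<in> words n. count_list u False = k}. of_real (1 / sqrt (n choose k)) * x w)"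
  proof (rule sum.mono_neutral_cong_right)
    fix u assume "u \<in> {u \<in> words n. count_list u False = k}"
    then show "e n k u * x u = of_real (1 / sqrt (n choose k)) * x w"
      using Ln_sym[OF assms, of u w] True k by (auto simp: k_def e_eq words_def)
  qed (use k in \<open>auto simp: e_eq\<close>)
  also have "\<dots> = of_nat (n choose k) * (of_real (1 / sqrt (n choose k)) * x w)"
    by (simp add: card_words_count)
  finally have S: "(\<Sum>u\<in>words n. e n k u * x u) = of_nat (n choose k) * (of_real (1 / sqrt (n choose k)) * x w)" .
  have "e n k w = of_real (1 / sqrt (n choose k))"
    using True k by (simp add: e_eq k_def words_def)
  with C(1) have a: "(\<Sum>u\<in>words n. e n k u * x u) * e n k w = x w"
    unfolding S C(2)[symmetric] by simp
  have "(\<Sum>i\<le>n. (\<Sum>u\<in>words n. e n i u * x u) * e n i w) =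
     (\<Sum>i\<in>{k}. (\<Sum>u\<in>words n. e n i u * x u) * e n i w)"
    using k by (intro sum.mono_neutral_right) (auto simp: e_eq k_def)
  also have "\<dots> = (\<Sum>u\<in>words n. e n k u * x u) * e n k w" by simp
  finally show ?thesis unfolding a by (rule sym)
next
  case False
  with Ln_tens_space[OF assms] show ?thesis by (simp add: tens_space_def words_def e_eq)
qed

lemma e_orthonormal:
  assumes "i \<le> n" "j \<le> n"
  shows "(\<Sum>u\<in>words n. e n i u * e n j u) = (if i = j then 1 else 0)"
proof (cases "i = j")
  case True
  have "(\<Sum>u\<in>words n. e n i u * e n j u) =
     (\<Sum>u\<in>{u \<in> words n. count_list u False = i}. of_real (1 / sqrt (n choose i)) * of_real (1 / sqrt (n choose i)))"
    using assms True by (intro sum.mono_neutral_cong_right finite_words) (auto simp: e_eq words_def)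
  also have "\<dots> = 1"
    using assms by (simp add: card_words_count flip: of_real_mult)
  finally show ?thesis using True by simp
next
  case False
  then show ?thesis using assms by (auto simp: e_eq intro!: sum.neutral)
qed

section \<open>Contractions and membership in tensor products with L_n\<close>

text \<open>Contraction of the first \<open>L_n\<close> factor with \<open>e_i\<close>; on \<open>E_{m+1}\<close> this is \<open>T_i\<^sup>*\<close>.\<close>
definition con :: "nat \<Rightarrow> nat \<Rightarrow> vec \<Rightarrow> vec" where
  "con n i x = (\<lambda>v. \<Sum>u\<in>words n. e n i u * x (u @ v))"

lemma tens_assoc: "tens (a + b) (tens a x y) z = tens a x (tens b y z)"
  by (simp add: tens_def take_drop add.commute mult.assoc)

lemma tens_append: "u \<in> words a \<Longrightarrow> tens a x y (u @ v) = x u * y v"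
  by (simp add: tens_def words_def)

lemma tens_tens_space:
  "x \<in> tens_space a \<Longrightarrow> y \<in> tens_space b \<Longrightarrow> tens a x y \<in> tens_space (a + b)"
  unfolding tens_space_def tens_def
proof (intro CollectI allI impI)
  fix w :: "bool list"
  assume xy: "x \<in> {x. \<forall>w. length w \<noteq> a \<longrightarrow> x w = 0}" "y \<in> {x. \<forall>w. length w \<noteq> b \<longrightarrow> x w = 0}"
    and w: "length w \<noteq> a + b"
  then have "length (take a w) \<noteq> a \<or> length (drop a w) \<noteq> b" by auto
  with xy show "x (take a w) * y (drop a w) = 0" by auto
qed

lemma con_tens: "con n i (tens n x y) = (\<lambda>v. (\<Sum>u\<in>words n. e n i u * x u) * y v)"
  by (simp add: con_def tens_append sum_distrib_right mult.assoc)

lemma con_tens_e: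
  "i \<le> n \<Longrightarrow> j \<le> n \<Longrightarrow> con n i (tens n (e n j) y) = (\<lambda>v. if i = j then y v else 0)"
  by (auto simp: con_tens e_orthonormal)

lemma con_sum: "con n i (\<lambda>w. \<Sum>k\<in>I. c k * x k w) = (\<lambda>w. \<Sum>k\<in>I. c k * con n i (x k) w)"
proof
  fix v
  have "con n i (\<lambda>w. \<Sum>k\<in>I. c k * x k w) v = (\<Sum>u\<in>words n. \<Sum>k\<in>I. c k * (e n i u * x k (u @ v)))"
    by (simp add: con_def sum_distrib_left mult.left_commute)
  also have "\<dots> = (\<Sum>k\<in>I. \<Sum>u\<in>words n. c k * (e n i u * x k (u @ v)))"
    by (rule sum.swap)
  finally show "con n i (\<lambda>w. \<Sum>k\<in>I. c k * x k w) v = (\<Sum>k\<in>I. c k * con n i (x k) v)"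
    by (simp add: con_def sum_distrib_left)
qed

lemma con_add: "con n i (\<lambda>w. x w + y w) = (\<lambda>w. con n i x w + con n i y w)"
  by (simp add: con_def distrib_left sum.distrib)

lemma con_scale: "con n i (\<lambda>w. c * x w) = (\<lambda>w. c * con n i x w)"
  by (simp add: con_def sum_distrib_left mult_ac)

lemma con_zero: "con n i (\<lambda>w. 0) = (\<lambda>w. 0)"
  by (simp add: con_def)

lemma con_tens_space: "x \<in> tens_space (n + N) \<Longrightarrow> con n i x \<in> tens_space N"
  by (auto simp: con_def tens_space_def words_def)

text \<open>Splitting words after \<open>n\<close> letters and exchanging sums shows that
  \<open>con n k\<close> is adjoint to tensoring with \<open>e n k\<close>; no conjugate appears in
  \<open>con\<close> because \<open>e n k\<close> is real.\<close>

lemma inner_tens_e: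
  assumes "z \<in> tens_space (n + N)" "k \<le> n"
  shows "inner_v (tens n (e n k) y) z = inner_v y (con n k z)"
proof -
  have "inner_v (tens n (e n k) y) z =
      (\<Sum>u\<in>words n. \<Sum>v\<in>words N. y v * (e n k u * cnj (z (u @ v))))"
    using assms(1) by (simp add: inner_words sum_words_append tens_append mult_ac)
  also have "\<dots> = (\<Sum>v\<in>words N. \<Sum>u\<in>words n. y v * (e n k u * cnj (z (u @ v))))"
    by (rule sum.swap)
  also have "\<dots> = inner_v y (con n k z)"
    using inner_words[OF con_tens_space[OF assms(1)]] assms(2)
    by (simp add: con_def e_cnj sum_distrib_left)
  finally show ?thesis .
qed

text \<open>This is p_n (x) 1 written in the orthonormal basis, so \<open>expand n x = x\<close>
  expresses symmetry in the first \<open>n\<close> legs.\<close>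

definition expand :: "nat \<Rightarrow> vec \<Rightarrow> vec" where
  "expand n x = (\<lambda>w. \<Sum>i\<le>n. tens n (e n i) (con n i x) w)"

lemma expand_zero: "expand n (\<lambda>w. 0) = (\<lambda>w. 0)"
  by (simp add: expand_def con_zero tens_def)

lemma expand_add: "expand n (\<lambda>w. x w + y w) = (\<lambda>w. expand n x w + expand n y w)"
  by (simp add: expand_def con_add tens_def distrib_left sum.distrib)

lemma expand_scale: "expand n (\<lambda>w. c * x w) = (\<lambda>w. c * expand n x w)"
  by (simp add: expand_def con_scale tens_def sum_distrib_left mult.left_commute)

text \<open>Replaces membership in a span by a test on contractions. The right-hand side is a
  subspace containing the elementary tensors; conversely \<open>expand n x\<close> is itself a
  combination of such tensors.\<close>

lemma tensor_Ln_iff: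
  assumes "subsp B"
  shows "x \<in> tensor_sp n (Ln n) B \<longleftrightarrow> (\<forall>i\<le>n. con n i x \<in> B) \<and> expand n x = x"
proof
  let ?G = "{tens n a b |a b. a \<in> Ln n \<and> b \<in> B}"
  let ?V = "{x. (\<forall>i\<le>n. con n i x \<in> B) \<and> expand n x = x}"
  have "subsp ?V"
    using assms
    by (simp add: subsp_def con_zero con_add con_scale expand_zero expand_add expand_scale)
  moreover have "?G \<subseteq> ?V"
  proof safe
    fix a b i assume ab: "a \<in> Ln n" "b \<in> B"
    show "con n i (tens n a b) \<in> B"
      using assms ab by (simp add: con_tens subsp_scale)
    show "expand n (tens n a b) = tens n a b"
    proof
      fix w
      define c where "c i = (\<Sum>u\<in>words n. e n i u * a u)" for i
      have con: "con n i (tens n a b) = (\<lambda>v. c i * b v)" for i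
        by (simp add: con_tens c_def)
      have "expand n (tens n a b) w = (\<Sum>i\<le>n. c i * e n i (take n w)) * b (drop n w)"
        unfolding expand_def con
        unfolding tens_def sum_distrib_right by (simp only: mult_ac)
      also have "(\<Sum>i\<le>n. c i * e n i (take n w)) = a (take n w)"
        unfolding c_def by (rule Ln_expand[OF ab(1), symmetric])
      finally show "expand n (tens n a b) w = tens n a b w"
        by (simp add: tens_def)
    qed
  qed
  ultimately have "tensor_sp n (Ln n) B \<subseteq> ?V"
    unfolding tensor_sp_def by (rule cspan_minimal)
  then show "x \<in> tensor_sp n (Ln n) B \<Longrightarrow> (\<forall>i\<le>n. con n i x \<in> B) \<and> expand n x = x" by auto
next
  assume x: "(\<forall>i\<le>n. con n i x \<in> B) \<and> expand n x = x"
  have "(\<lambda>w. \<Sum>i\<le>n. 1 * tens n (e n i) (con n i x) w) \<in> tensor_sp n (Ln n) B"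
    unfolding tensor_sp_def using x e_Ln
    by (intro subsp_sum subsp_cspan) (blast intro: cspan_superset)
  then show "x \<in> tensor_sp n (Ln n) B" using x by (simp add: expand_def)
qed

lemma expand_eqI:
  assumes "x \<in> tens_space (n + N)" "\<And>v. v \<in> words N \<Longrightarrow> (\<lambda>u. x (u @ v)) \<in> Ln n"
  shows "expand n x = x"
proof
  fix w
  show "expand n x w = x w"
  proof (cases "length w = n + N")
    case True
    then have *: "drop n w \<in> words N" by (simp add: words_def)
    show ?thesis
      using Ln_expand[OF assms(2)[OF *], of "take n w"]
      by (simp add: expand_def con_def tens_def mult.commute)
  next
    case False
    have "tens n (e n i) (con n i x) \<in> tens_space (n + N)" if "i \<le> n" for i
      using that assms(1) by (intro tens_tens_space con_tens_space Ln_tens_space[OF e_Ln])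
    with False assms(1) show ?thesis by (auto simp: expand_def tens_space_def)
  qed
qed

section \<open>Invariant vectors\<close>

text \<open>The vector spanning the invariants \<open>D_2\<close>.\<close>
definition dl :: "nat \<Rightarrow> vec" where
  "dl n = (\<lambda>w. \<Sum>k\<le>n. (-1) ^ k * tens n (e n k) (e n (n - k)) w)"

lemma dl_tens_space: "dl n \<in> tens_space (n + n)"
  unfolding dl_def
  by (intro subsp_sum subsp_tens_space tens_tens_space Ln_tens_space[OF e_Ln]) auto

lemma dl_append:
  assumes u: "u \<in> words n" and v: "v \<in> words n"
  shows "dl n (u @ v) = (if count_list v False = n - count_list u False
     then (-1) ^ count_list u False / of_nat (n choose count_list u False) else 0)"
proof -
  define k where "k = count_list u False"
  have k: "k \<le> n" using count_list_words_le[OF u] by (simp add: k_def)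
  have "dl n (u @ v) = (\<Sum>j\<le>n. (-1) ^ j * (e n j u * e n (n - j) v))"
    by (simp add: dl_def tens_append[OF u])
  also have "\<dots> = (\<Sum>j\<in>{k}. (-1) ^ j * (e n j u * e n (n - j) v))"
    using k by (intro sum.mono_neutral_right) (auto simp: e_eq k_def)
  also have "\<dots> = (-1) ^ k * (e n k u * e n (n - k) v)" by simp
  also have "e n k u = of_real (1 / sqrt (n choose k))"
    using u k by (simp add: e_eq k_def words_def)
  also have "e n (n - k) v = (if count_list v False = n - k then of_real (1 / sqrt (n choose k)) else 0)"
    using v k by (simp add: e_eq words_def flip: binomial_symmetric)
  also have "(-1) ^ k * (complex_of_real (1 / sqrt (n choose k)) *
      (if count_list v False = n - k then of_real (1 / sqrt (n choose k)) else 0)) =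
      (if count_list v False = n - k then (-1) ^ k / of_nat (n choose k) else 0)"
  proof -
    have "complex_of_real (1 / sqrt (n choose k)) * of_real (1 / sqrt (n choose k)) = 1 / of_nat (n choose k)"
      unfolding of_real_mult[symmetric] by simp
    then show ?thesis by (auto simp: divide_inverse)
  qed
  finally show ?thesis by (simp add: k_def)
qed

lemma prod_lessThan_add:
  fixes f :: "nat \<Rightarrow> 'a::comm_monoid_mult"
  shows "(\<Prod>j<a + b. f j) = (\<Prod>j<a. f j) * (\<Prod>j<b. f (a + j))"
  by (induction b) (simp_all add: mult.assoc)

lemma tensor_Ln_Ln_sym:
  assumes x: "x \<in> tensor_sp n (Ln n) (Ln n)"
    and u: "u \<in> words n" "u' \<in> words n" "count_list u False = count_list u' False"
    and v: "v \<in> words n" "v' \<in> words n" "count_list v False = count_list v' False"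
  shows "x (u @ v) = x (u' @ v')"
proof -
  have con: "\<And>i. i \<le> n \<Longrightarrow> con n i x \<in> Ln n" and ex: "expand n x = x"
    using x tensor_Ln_iff[OF subsp_Ln] by blast+
  have "expand n x (u @ v) = expand n x (u' @ v')"
    unfolding expand_def
  proof (rule sum.cong[OF refl])
    fix i assume "i \<in> {..n}"
    then have "e n i u = e n i u'" "con n i x v = con n i x v'"
      using Ln_sym[OF e_Ln u] Ln_sym[OF con v] by simp_all
    then show "tens n (e n i) (con n i x) (u @ v) = tens n (e n i) (con n i x) (u' @ v')"
      using u v by (simp add: tens_append)
  qed
  then show ?thesis by (simp add: ex)
qed

lemma tensor_Ln_Ln_tens_space: "x \<in> tensor_sp n (Ln n) (Ln n) \<Longrightarrow> x \<in> tens_space (n + n)"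
proof -
  have "tensor_sp n (Ln n) (Ln n) \<subseteq> tens_space (n + n)"
    unfolding tensor_sp_def
    by (intro cspan_minimal subsp_tens_space) (auto intro: tens_tens_space Ln_tens_space)
  then show "x \<in> tensor_sp n (Ln n) (Ln n) \<Longrightarrow> x \<in> tens_space (n + n)" by blast
qed

lemma tpow_op_eq:
  "tpow_op U N x = (\<lambda>w. if length w = N then \<Sum>v\<in>words N. (\<Prod>j<N. U (w ! j) (v ! j)) * x v else 0)"
  by (simp only: tpow_op_def words_def)

lemma D2_fixed:
  assumes "x \<in> D2 n" "su2 U" "w \<in> words (n + n)"
  shows "x w = (\<Sum>v\<in>words (n + n). (\<Prod>j<n + n. U (w ! j) (v ! j)) * x v)"
proof -
  have "tpow_op U (2 * n) x = x" using assms by (simp add: D2_def)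
  then have "x w = tpow_op U (2 * n) x w" by simp
  then show ?thesis using assms(3) by (simp add: tpow_op_eq words_def mult_2)
qed

text \<open>Tested on \<open>diag(z, z\<inverse>)\<close> with \<open>z\<close> chosen so that it acts on the coordinate \<open>w\<close> by \<open>-1\<close>.\<close>
lemma D2_weight_zero:
  assumes x: "x \<in> D2 n" and w: "w \<in> words (n + n)" and c: "count_list w False \<noteq> n"
  shows "x w = 0"
proof -
  define F where "F = count_list w False"
  define G where "G = count_list w True"
  have FG: "F + G = n + n" using count_list_bool[of w] w by (simp add: F_def G_def words_def)
  \<comment> \<open>The angle solves (F - G) a = pi; since F + G = 2 n, equality F = G would mean F
    = n, against \<open>c\<close>.\<close>
  define a where "a = pi / (real F - real G)"
  have "real F - real G \<noteq> 0" using FG c by (simp add: F_def)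
  then have a: "real F * a - real G * a = pi"
    unfolding left_diff_distrib[symmetric] a_def by simp
  define U where "U = (\<lambda>i j::bool. if i \<noteq> j then 0 else if i then cnj (cis a) else cis a)"
  have "su2 U" by (auto simp: su2_def U_def UNIV_bool cis_cnj cis_mult)
  have z: "(\<Prod>j<n + n. U (w ! j) (v ! j)) = 0" if v: "v \<in> words (n + n)" "v \<noteq> w" for v
  proof -
    obtain j where "j < n + n" "w ! j \<noteq> v ! j"
      using v w nth_equalityI[of w v] by (auto simp: words_def)
    then show ?thesis by (intro prod_zero) (auto simp: U_def)
  qed
  have "x w = (\<Sum>v\<in>words (n + n). (\<Prod>j<n + n. U (w ! j) (v ! j)) * x v)"
    by (rule D2_fixed[OF x \<open>su2 U\<close> w])
  also have "\<dots> = (\<Sum>v\<in>{w}. (\<Prod>j<n + n. U (w ! j) (v ! j)) * x v)"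
    using w by (intro sum.mono_neutral_right) (auto simp: z)
  also have "\<dots> = (\<Prod>j<length w. U (w ! j) (w ! j)) * x w"
    using w by (simp add: words_def)
  also have "(\<Prod>j<length w. U (w ! j) (w ! j)) = cis a ^ F * cnj (cis a) ^ G"
    unfolding F_def G_def by (subst prod_nth_bool) (simp add: U_def)
  also have "\<dots> = cis (real F * a - real G * a)"
    by (simp add: cis_cnj Complex.DeMoivre cis_mult)
  also have "\<dots> = -1" by (simp add: a)
  finally show ?thesis by simp
qed

text \<open>The difference of both sides is a polynomial with infinitely many roots. Only
  \<open>t \<ge> 0\<close> is asked for, because the rotations below involve the square root of
  \<open>t\<close>.\<close>

lemma binomial_poly_unique:
  fixes b :: "nat \<Rightarrow> complex" and g :: complex
  assumes "\<And>t::real. t \<ge> 0 \<Longrightarrow> (\<Sum>k\<le>n. b k * of_real t ^ k) = (1 + of_real t) ^ n * g"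
  shows "k \<le> n \<Longrightarrow> b k = of_nat (n choose k) * g"
proof -
  have "(\<Sum>k\<le>n. (b k - of_nat (n choose k) * g) * of_real t ^ k) = 0" if "t \<ge> 0" for t :: real
  proof -
    have "(1 + of_real t) ^ n * g = (\<Sum>k\<le>n. of_nat (n choose k) * g * of_real t ^ k)"
      using binomial_ring[of "complex_of_real t" 1 n]
      by (simp add: add.commute sum_distrib_right mult_ac flip: sum_distrib_left)
    with assms[OF that] show ?thesis by (simp add: left_diff_distrib sum_subtractf)
  qed
  then have "complex_of_real ` {0..} \<subseteq> {z. (\<Sum>k\<le>n. (b k - of_nat (n choose k) * g) * z ^ k) = 0}"
    by auto
  moreover have "infinite (complex_of_real ` {0..})"
    by (subst finite_image_iff) (auto simp: inj_on_def infinite_Ici)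
  ultimately have "infinite {z. (\<Sum>k\<le>n. (b k - of_nat (n choose k) * g) * z ^ k) = 0}"
    using finite_subset by blast
  then show "k \<le> n \<Longrightarrow> b k = of_nat (n choose k) * g"
    unfolding polyfun_finite_roots by auto
qed

text \<open>Invariance under rotations, read off at the single coordinate \<open>f_0\<^sup>n \<otimes> f_1\<^sup>n\<close>,
  is a polynomial identity in the rotation parameter that fixes all coordinates.\<close>
lemma D2_multiple:
  assumes x: "x \<in> D2 n"
  shows "\<exists>c. x = (\<lambda>w. c * dl n w)"
proof -
  have xt: "x \<in> tensor_sp n (Ln n) (Ln n)" using x by (simp add: D2_def)
  define rep where "rep k = replicate k False @ replicate (n - k) True" for k
  have rep: "rep k \<in> words n" "count_list (rep k) False = k" if "k \<le> n" for k
    using that by (auto simp: rep_def words_def simp flip: count_mset)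
  define G where "G k = x (rep k @ rep (n - k))" for k
  \<comment> \<open>Symmetry in both halves and vanishing off weight zero reduce \<open>x\<close> to
    the n + 1 numbers \<open>G k\<close>.\<close>
  have xG: "x (u @ v) = (if count_list v False = n - count_list u False then G (count_list u False) else 0)"
    if u: "u \<in> words n" and v: "v \<in> words n" for u v
  proof (cases "count_list v False = n - count_list u False")
    case True
    have "x (u @ v) = G (count_list u False)"
      unfolding G_def using True count_list_words_le[OF u] u v rep
      by (intro tensor_Ln_Ln_sym[OF xt]) auto
    with True show ?thesis by simp
  next
    case False
    moreover have "x (u @ v) = 0"
      using u v count_list_words_le[OF u] False
      by (intro D2_weight_zero[OF x]) (auto simp: words_def simp flip: count_mset)
    ultimately show ?thesis by simp
  qed
  have poly: "(\<Sum>k\<le>n. of_nat (n choose k) * of_nat (n choose k) * (-1) ^ (n - k) * G k * of_real t ^ k)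
      = (1 + of_real t) ^ n * G n" if t: "t \<ge> 0" for t :: real
  proof -
    \<comment> \<open>Cosine and sine of the rotation with squared cotangent \<open>t\<close>: c^2 =
      t s^2 and s^2 = 1/(1 + t), so a product of n factors c^2 or s^2 is a power of \<open>t\<close>
      divided by (1 + t)^n.\<close>
    define c where "c = complex_of_real (sqrt (t / (1 + t)))"
    define s where "s = complex_of_real (sqrt (1 / (1 + t)))"
    have cc: "c * c = of_real (t / (1 + t))"
      using t by (simp add: c_def flip: of_real_mult)
    have ss: "s * s = of_real (1 / (1 + t))"
      using t by (simp add: s_def flip: of_real_mult)
    have cs: "c * c = of_real t * (s * s)"
      unfolding cc ss by (simp flip: of_real_mult)
    have s1: "(1 + of_real t) * (s * s) = 1"
    proof -
      have "(1 + of_real t) * (s * s) = complex_of_real ((1 + t) * (1 / (1 + t)))"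
        unfolding ss of_real_mult by simp
      also have "(1 + t) * (1 / (1 + t)) = 1" using t by simp
      finally show ?thesis by simp
    qed
    have cs1: "c * c + s * s = 1"
      using s1 unfolding cs by (simp add: algebra_simps)
    define U where "U = (\<lambda>i j::bool. if i = j then c else if i then s else - s)"
    have "cnj c = c" "cnj s = s" by (simp_all add: c_def s_def)
    then have "su2 U" using cs1 by (auto simp: su2_def U_def UNIV_bool add.commute)
    have w0: "rep n @ rep 0 \<in> words (n + n)" using rep by (auto simp: words_def rep_def)
    have pr: "(\<Prod>j<n + n. U ((rep n @ rep 0) ! j) ((u @ v) ! j)) =
      c ^ count_list u False * (- s) ^ (n - count_list u False) *
      (s ^ count_list v False * c ^ (n - count_list v False))"
      if u: "u \<in> words n" and v: "v \<in> words n" for u v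
    proof -
      have "(\<Prod>j<n + n. U ((rep n @ rep 0) ! j) ((u @ v) ! j)) =
        (\<Prod>j<length u. U False (u ! j)) * (\<Prod>j<length v. U True (v ! j))"
        unfolding prod_lessThan_add using u v
        by (intro arg_cong2[of _ _ _ _ "(*)"] prod.cong) (auto simp: rep_def words_def nth_append)
      moreover have "count_list u True = n - count_list u False" "count_list v True = n - count_list v False"
        using count_list_bool[of u] count_list_bool[of v] u v by (auto simp: words_def)
      ultimately show ?thesis
        unfolding prod_nth_bool by (simp add: U_def)
    qed
    have "G n = x (rep n @ rep 0)" by (simp add: G_def)
    also have "\<dots> = (\<Sum>w\<in>words (n + n). (\<Prod>j<n + n. U ((rep n @ rep 0) ! j) (w ! j)) * x w)"
      by (rule D2_fixed[OF x \<open>su2 U\<close> w0])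
    also have "\<dots> = (\<Sum>u\<in>words n. \<Sum>v\<in>words n.
       c ^ count_list u False * (- s) ^ (n - count_list u False) *
      (s ^ count_list v False * c ^ (n - count_list v False)) *
      (if count_list v False = n - count_list u False then G (count_list u False) else 0))"
      unfolding sum_words_append by (intro sum.cong refl) (simp only: pr xG)
    also have "\<dots> = (\<Sum>u\<in>words n. \<Sum>l\<le>n. of_nat (n choose l) *
       (c ^ count_list u False * (- s) ^ (n - count_list u False) * (s ^ l * c ^ (n - l)) *
      (if l = n - count_list u False then G (count_list u False) else 0)))"
      by (intro sum.cong refl sum_words_count)
    also have "\<dots> = (\<Sum>k\<le>n. of_nat (n choose k) * (\<Sum>l\<le>n. of_nat (n choose l) *
       (c ^ k * (- s) ^ (n - k) * (s ^ l * c ^ (n - l)) * (if l = n - k then G k else 0))))"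
      by (rule sum_words_count)
    also have "\<dots> = (\<Sum>k\<le>n. of_nat (n choose k) * of_nat (n choose k) * (-1) ^ (n - k) * G k *
        of_real t ^ k * (s * s) ^ n)"
    proof (rule sum.cong[OF refl])
      fix k assume "k \<in> {..n}"
      then have k: "k \<le> n" by simp
      \<comment> \<open>Only l = n - k survives; the exponents then pair up into c^2 and s^2, with n
        such factors in all.\<close>
      have "(\<Sum>l\<le>n. of_nat (n choose l) *
         (c ^ k * (- s) ^ (n - k) * (s ^ l * c ^ (n - l)) * (if l = n - k then G k else 0))) =
        (\<Sum>l\<in>{n - k}. of_nat (n choose l) * (c ^ k * (- s) ^ (n - k) * (s ^ l * c ^ (n - l)) * G k))"
        by (rule sum.mono_neutral_cong_right) auto
      also have "\<dots> = of_nat (n choose k) * ((c * c) ^ k * ((-1) ^ (n - k) * (s * s) ^ (n - k)) * G k)"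
        using k by (simp add: power_minus[of s] power_mult_distrib mult_ac flip: binomial_symmetric)
      also have "\<dots> = of_nat (n choose k) * (-1) ^ (n - k) * G k * of_real t ^ k * ((s * s) ^ k * (s * s) ^ (n - k))"
        unfolding cs power_mult_distrib by (simp only: mult_ac)
      also have "(s * s) ^ k * (s * s) ^ (n - k) = (s * s) ^ n"
        using k by (simp flip: power_add)
      finally show "of_nat (n choose k) * (\<Sum>l\<le>n. of_nat (n choose l) *
         (c ^ k * (- s) ^ (n - k) * (s ^ l * c ^ (n - l)) * (if l = n - k then G k else 0))) =
         of_nat (n choose k) * of_nat (n choose k) * (-1) ^ (n - k) * G k *
        of_real t ^ k * (s * s) ^ n"
        by (simp only: mult.assoc)
    qed
    finally have "(1 + of_real t) ^ n * G n = ((1 + of_real t) * (s * s)) ^ n *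
       (\<Sum>k\<le>n. of_nat (n choose k) * of_nat (n choose k) * (-1) ^ (n - k) * G k * of_real t ^ k)"
      by (simp add: sum_distrib_left sum_distrib_right power_mult_distrib mult_ac)
    then show ?thesis by (simp add: s1)
  qed
  \<comment> \<open>Comparing coefficients of t^k leaves \<open>G n\<close> as the only free number;
    (-1)^(n - k) is split as (-1)^n (-1)^k to match the signs of \<open>dl\<close>.\<close>
  have Gk: "G k = (-1) ^ n * G n * ((-1) ^ k / of_nat (n choose k))" if k: "k \<le> n" for k
  proof -
    have "of_nat (n choose k) * of_nat (n choose k) * (-1) ^ (n - k) * G k = of_nat (n choose k) * G n"
      by (rule binomial_poly_unique[OF _ k]) (rule poly)
    moreover have "of_nat (n choose k) \<noteq> (0::complex)" using k by simp
    ultimately have "G n / of_nat (n choose k) = (-1) ^ (n - k) * G k"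
      by (simp add: field_simps)
    then have "(-1) ^ (n - k) * (G n / of_nat (n choose k)) = G k"
      by (simp flip: power_add mult.assoc add: mult_2[symmetric])
    moreover have "(-1) ^ (n - k) = (-1) ^ n * (-1::complex) ^ k"
      using k by (simp add: minus_one_power_iff)
    ultimately show ?thesis by (simp add: mult_ac)
  qed
  have "x w = (-1) ^ n * G n * dl n w" for w
  proof (cases "length w = n + n")
    case True
    then have w: "take n w \<in> words n" "drop n w \<in> words n" by (auto simp: words_def)
    have "x (take n w @ drop n w) = (-1) ^ n * G n * dl n (take n w @ drop n w)"
      unfolding xG[OF w] dl_append[OF w] using Gk[OF count_list_words_le[OF w(1)]] by simp
    then show ?thesis by simp
  next
    case False
    then show ?thesis
      using tensor_Ln_Ln_tens_space[OF xt] dl_tens_space[of n] by (simp add: tens_space_def)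
  qed
  then show ?thesis by blast
qed

section \<open>An explicit non-zero invariant vector\<close>

definition eps :: "bool \<Rightarrow> bool \<Rightarrow> complex" where
  "eps a b = (if a = b then 0 else if a then -1 else 1)"

text \<open>Pairing the \<open>2n\<close> legs by copies of the invariant tensor \<open>f_0 \<otimes> f_1 - f_1 \<otimes> f_0\<close> and symmetrising
  gives an invariant vector. Being non-zero, it is a multiple of \<open>dl\<close> by \<open>D2_multiple\<close>, so no coefficient
  has to be counted.\<close>
definition eps_sym :: "nat \<Rightarrow> bool list \<Rightarrow> bool list \<Rightarrow> complex" where
  "eps_sym n u v = (\<Sum>\<sigma> | \<sigma> permutes {..<n}. \<Prod>j<n. eps (u ! j) (v ! \<sigma> j))"

text \<open>The substitution of \<sigma> \<circ> \<tau> for \<sigma> absorbs the permutation. A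
  single sum over permutations thus symmetrises both halves, the right one by composing on the other
  side.\<close>

lemma eps_sym_permute_left:
  assumes "\<tau> permutes {..<n}"
  shows "eps_sym n (map (\<lambda>j. u ! \<tau> j) [0..<n]) v = eps_sym n u v"
proof -
  have "eps_sym n (map (\<lambda>j. u ! \<tau> j) [0..<n]) v =
      (\<Sum>\<sigma> | \<sigma> permutes {..<n}. \<Prod>j<n. eps (u ! \<tau> j) (v ! (\<sigma> \<circ> \<tau>) j))"
    unfolding eps_sym_def by (subst sum_permutations_compose_right[OF assms]) simp
  also have "\<dots> = (\<Sum>\<sigma> | \<sigma> permutes {..<n}. \<Prod>j<n. eps (u ! j) (v ! \<sigma> j))"
    by (subst (2) prod.permute[OF assms]) (simp add: o_def)
  finally show ?thesis by (simp add: eps_sym_def)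
qed

lemma eps_sym_permute_right:
  assumes "\<tau> permutes {..<n}"
  shows "eps_sym n u (map (\<lambda>j. v ! \<tau> j) [0..<n]) = eps_sym n u v"
proof -
  have "eps_sym n u (map (\<lambda>j. v ! \<tau> j) [0..<n]) =
      (\<Sum>\<sigma> | \<sigma> permutes {..<n}. \<Prod>j<n. eps (u ! j) (v ! (\<tau> \<circ> \<sigma>) j))"
    unfolding eps_sym_def
  proof (intro sum.cong prod.cong refl)
    fix \<sigma> j assume "\<sigma> \<in> {\<sigma>. \<sigma> permutes {..<n}}" "j \<in> {..<n}"
    then have "\<sigma> j < n" using permutes_in_image[of \<sigma> "{..<n}" j] by simp
    then show "eps (u ! j) (map (\<lambda>j. v ! \<tau> j) [0..<n] ! \<sigma> j) = eps (u ! j) (v ! (\<tau> \<circ> \<sigma>) j)"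
      by simp
  qed
  also have "\<dots> = eps_sym n u v"
    unfolding eps_sym_def by (rule setum_permutations_compose_left[OF assms, symmetric])
  finally show ?thesis .
qed

definition eps_vec :: "nat \<Rightarrow> vec" where
  "eps_vec n w = (if length w = n + n then eps_sym n (take n w) (drop n w) else 0)"

lemma eps_vec_append:
  "u \<in> words n \<Longrightarrow> v \<in> words n \<Longrightarrow> eps_vec n (u @ v) = eps_sym n u v"
  by (simp add: eps_vec_def words_def)

text \<open>Through \<open>tensor_Ln_iff\<close>: symmetry in the right half puts the contractions
  into \<open>Ln n\<close>, symmetry in the left half gives the fixed point of
  \<open>expand\<close>.\<close>

lemma eps_vec_tensor: "eps_vec n \<in> tensor_sp n (Ln n) (Ln n)"
proof -
  have "con n i (eps_vec n) \<in> Ln n" for i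
  proof -
    have "(\<lambda>v. eps_vec n (u @ v)) \<in> Ln n" if u: "u \<in> words n" for u
      unfolding Ln_def
    proof (intro CollectI conjI allI impI)
      show "(\<lambda>v. eps_vec n (u @ v)) \<in> tens_space n"
        using u by (simp add: tens_space_def eps_vec_def words_def)
      fix \<sigma> and w :: "bool list" assume w: "\<sigma> permutes {..<n} \<and> length w = n"
      then have "w \<in> words n" "map (\<lambda>j. w ! \<sigma> j) [0..<n] \<in> words n" by (auto simp: words_def)
      then show "eps_vec n (u @ map (\<lambda>j. w ! \<sigma> j) [0..<n]) = eps_vec n (u @ w)"
        using w u by (simp add: eps_vec_append eps_sym_permute_right)
    qed
    then show ?thesis unfolding con_def by (intro subsp_sum subsp_Ln)
  qed
  moreover have "expand n (eps_vec n) = eps_vec n"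
  proof (rule expand_eqI)
    fix v assume v: "v \<in> words n"
    show "(\<lambda>u. eps_vec n (u @ v)) \<in> Ln n"
      unfolding Ln_def
    proof (intro CollectI conjI allI impI)
      show "(\<lambda>u. eps_vec n (u @ v)) \<in> tens_space n"
        using v by (simp add: tens_space_def eps_vec_def words_def)
      fix \<sigma> and w :: "bool list" assume w: "\<sigma> permutes {..<n} \<and> length w = n"
      then have "w \<in> words n" "map (\<lambda>j. w ! \<sigma> j) [0..<n] \<in> words n" by (auto simp: words_def)
      then show "eps_vec n (map (\<lambda>j. w ! \<sigma> j) [0..<n] @ v) = eps_vec n (w @ v)"
        using w v by (simp add: eps_vec_append eps_sym_permute_left)
    qed
  qed (simp add: tens_space_def eps_vec_def)
  ultimately show ?thesis by (simp add: tensor_Ln_iff[OF subsp_Ln])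
qed

text \<open>Entrywise, U eps U^T = det(U) eps with determinant 1.\<close>

lemma su2_eps:
  assumes "su2 U"
  shows "(\<Sum>a\<in>UNIV. \<Sum>b\<in>UNIV. U p a * U q b * eps a b) = eps p q"
  using assms by (cases p; cases q) (simp_all add: su2_def UNIV_bool eps_def algebra_simps)

text \<open>Letter j of \<open>u\<close> meets only letter \<sigma>(j) of \<open>v\<close>;
  reindexing the factors by the inverse of \<sigma> decouples the double sum into sums over pairs of
  letters.\<close>

lemma sum_words_prod_permute:
  fixes h :: "nat \<Rightarrow> bool \<Rightarrow> bool \<Rightarrow> 'a::comm_semiring_1"
  assumes \<sigma>: "\<sigma> permutes {..<n}"
  shows "(\<Sum>u\<in>words n. \<Sum>v\<in>words n. \<Prod>j<n. h j (u ! j) (v ! \<sigma> j)) =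
    (\<Prod>j<n. \<Sum>a\<in>UNIV. \<Sum>b\<in>UNIV. h j a b)"
proof -
  let ?\<tau> = "inv \<sigma>"
  have \<tau>: "?\<tau> permutes {..<n}" by (rule permutes_inv[OF \<sigma>])
  have "(\<Sum>v\<in>words n. \<Prod>j<n. h j (u ! j) (v ! \<sigma> j)) = (\<Prod>j<n. \<Sum>b\<in>UNIV. h j (u ! j) b)" for u
  proof -
    have "(\<Sum>v\<in>words n. \<Prod>j<n. h j (u ! j) (v ! \<sigma> j)) =
        (\<Sum>v\<in>words n. \<Prod>j<n. h (?\<tau> j) (u ! ?\<tau> j) (v ! j))"
      by (subst prod.permute[OF \<tau>]) (simp add: o_def permutes_inverses[OF \<sigma>])
    also have "\<dots> = (\<Prod>j<n. \<Sum>b\<in>UNIV. h (?\<tau> j) (u ! ?\<tau> j) b)"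
      by (rule sum_prod_words)
    also have "\<dots> = (\<Prod>j<n. \<Sum>b\<in>UNIV. h j (u ! j) b)"
      by (subst (2) prod.permute[OF \<tau>]) (simp add: o_def)
    finally show ?thesis .
  qed
  then have "(\<Sum>u\<in>words n. \<Sum>v\<in>words n. \<Prod>j<n. h j (u ! j) (v ! \<sigma> j)) =
     (\<Sum>u\<in>words n. \<Prod>j<n. \<Sum>b\<in>UNIV. h j (u ! j) b)"
    by simp
  also have "\<dots> = (\<Prod>j<n. \<Sum>a\<in>UNIV. \<Sum>b\<in>UNIV. h j a b)"
    by (rule sum_prod_words)
  finally show ?thesis .
qed

text \<open>For each fixed \<sigma> the operator acts pair by pair, and \<open>su2_eps\<close>
  reproduces every pair.\<close>

lemma eps_vec_invariant:
  assumes "su2 U"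
  shows "tpow_op U (2 * n) (eps_vec n) = eps_vec n"
proof
  fix w :: "bool list"
  show "tpow_op U (2 * n) (eps_vec n) w = eps_vec n w"
  proof (cases "length w = n + n")
    case True
    define p where "p = take n w"
    define q where "q = drop n w"
    have w: "w = p @ q" and len: "length p = n" "length q = n"
      using True by (simp_all add: p_def q_def)
    then have pq: "p \<in> words n" "q \<in> words n" by (simp_all add: words_def)
    have pr: "(\<Prod>j<n + n. U (w ! j) ((u @ v) ! j)) * eps_vec n (u @ v) =
       (\<Sum>\<sigma> | \<sigma> permutes {..<n}.
          \<Prod>j<n. U (p ! j) (u ! j) * U (q ! \<sigma> j) (v ! \<sigma> j) * eps (u ! j) (v ! \<sigma> j))"
      if u: "u \<in> words n" and v: "v \<in> words n" for u v
    proof -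
      have "(\<Prod>j<n + n. U (w ! j) ((u @ v) ! j)) = (\<Prod>j<n. U (p ! j) (u ! j)) * (\<Prod>j<n. U (q ! j) (v ! j))"
        unfolding prod_lessThan_add w using u v len
        by (intro arg_cong2[of _ _ _ _ "(*)"] prod.cong) (auto simp: words_def nth_append)
      then have "(\<Prod>j<n + n. U (w ! j) ((u @ v) ! j)) * eps_vec n (u @ v) =
         (\<Sum>\<sigma> | \<sigma> permutes {..<n}. (\<Prod>j<n. U (p ! j) (u ! j)) * (\<Prod>j<n. U (q ! j) (v ! j)) *
            (\<Prod>j<n. eps (u ! j) (v ! \<sigma> j)))"
        by (simp add: eps_vec_append[OF u v] eps_sym_def sum_distrib_left)
      also have "\<dots> = (\<Sum>\<sigma> | \<sigma> permutes {..<n}.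
          \<Prod>j<n. U (p ! j) (u ! j) * U (q ! \<sigma> j) (v ! \<sigma> j) * eps (u ! j) (v ! \<sigma> j))"
      proof (rule sum.cong[OF refl])
        fix \<sigma> assume "\<sigma> \<in> {\<sigma>. \<sigma> permutes {..<n}}"
        \<comment> \<open>Reindexing by \<sigma> places each factor of the second half beside the
          letter it is paired with.\<close>
        then have "(\<Prod>j<n. U (q ! j) (v ! j)) = (\<Prod>j<n. U (q ! \<sigma> j) (v ! \<sigma> j))"
          by (subst prod.permute[of \<sigma>]) (simp_all add: o_def)
        then show "(\<Prod>j<n. U (p ! j) (u ! j)) * (\<Prod>j<n. U (q ! j) (v ! j)) * (\<Prod>j<n. eps (u ! j) (v ! \<sigma> j)) =
          (\<Prod>j<n. U (p ! j) (u ! j) * U (q ! \<sigma> j) (v ! \<sigma> j) * eps (u ! j) (v ! \<sigma> j))"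
          by (simp add: prod.distrib)
      qed
      finally show ?thesis .
    qed
    have "tpow_op U (2 * n) (eps_vec n) w =
        (\<Sum>v\<in>words (n + n). (\<Prod>j<n + n. U (w ! j) (v ! j)) * eps_vec n v)"
      using True by (simp add: tpow_op_eq mult_2)
    also have "\<dots> = (\<Sum>u\<in>words n. \<Sum>v\<in>words n. \<Sum>\<sigma> | \<sigma> permutes {..<n}.
          \<Prod>j<n. U (p ! j) (u ! j) * U (q ! \<sigma> j) (v ! \<sigma> j) * eps (u ! j) (v ! \<sigma> j))"
      unfolding sum_words_append by (intro sum.cong refl pr)
    also have "\<dots> = (\<Sum>u\<in>words n. \<Sum>\<sigma> | \<sigma> permutes {..<n}. \<Sum>v\<in>words n.
          \<Prod>j<n. U (p ! j) (u ! j) * U (q ! \<sigma> j) (v ! \<sigma> j) * eps (u ! j) (v ! \<sigma> j))"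
      by (intro sum.cong refl sum.swap)
    also have "\<dots> = (\<Sum>\<sigma> | \<sigma> permutes {..<n}. \<Sum>u\<in>words n. \<Sum>v\<in>words n.
          \<Prod>j<n. U (p ! j) (u ! j) * U (q ! \<sigma> j) (v ! \<sigma> j) * eps (u ! j) (v ! \<sigma> j))"
      by (rule sum.swap)
    also have "\<dots> = (\<Sum>\<sigma> | \<sigma> permutes {..<n}. \<Prod>j<n. \<Sum>a\<in>UNIV. \<Sum>b\<in>UNIV.
          U (p ! j) a * U (q ! \<sigma> j) b * eps a b)"
    proof (rule sum.cong[OF refl])
      fix \<sigma> assume "\<sigma> \<in> {\<sigma>. \<sigma> permutes {..<n}}"
      then show "(\<Sum>u\<in>words n. \<Sum>v\<in>words n.
          \<Prod>j<n. U (p ! j) (u ! j) * U (q ! \<sigma> j) (v ! \<sigma> j) * eps (u ! j) (v ! \<sigma> j)) =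
        (\<Prod>j<n. \<Sum>a\<in>UNIV. \<Sum>b\<in>UNIV. U (p ! j) a * U (q ! \<sigma> j) b * eps a b)"
        using sum_words_prod_permute[of \<sigma> n "\<lambda>j a b. U (p ! j) a * U (q ! \<sigma> j) b * eps a b"] by simp
    qed
    also have "\<dots> = eps_sym n p q"
      unfolding su2_eps[OF assms] eps_sym_def ..
    finally show ?thesis by (simp add: w eps_vec_append[OF pq])
  qed (simp add: tpow_op_def eps_vec_def mult_2)
qed

lemma eps_vec_D2: "eps_vec n \<in> D2 n"
  by (simp add: D2_def eps_vec_tensor eps_vec_invariant)

lemma tpow_op_scale: "tpow_op U N (\<lambda>w. c * x w) = (\<lambda>w. c * tpow_op U N x w)"
  by (auto simp: tpow_op_def sum_distrib_left fun_eq_iff mult.left_commute)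

lemma D2_scale: "x \<in> D2 n \<Longrightarrow> (\<lambda>w. c * x w) \<in> D2 n"
  by (simp add: D2_def tpow_op_scale tensor_sp_def subsp_scale[OF subsp_cspan])

text \<open>At f_0^n (x) f_1^n every pairing contributes 1, so nothing cancels and the value is
  n!.\<close>

lemma eps_vec_nonzero: "eps_vec n (replicate n False @ replicate n True) \<noteq> 0"
proof -
  have "eps_sym n (replicate n False) (replicate n True) = (\<Sum>\<sigma> | \<sigma> permutes {..<n}. 1)"
    unfolding eps_sym_def
  proof (intro sum.cong prod.neutral refl ballI)
    fix \<sigma> j assume "\<sigma> \<in> {\<sigma>. \<sigma> permutes {..<n}}" "j \<in> {..<n}"
    then have "\<sigma> j < n" "j < n" using permutes_in_image[of \<sigma> "{..<n}" j] by simp_all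
    then show "eps (replicate n False ! j) (replicate n True ! \<sigma> j) = 1"
      by (simp add: eps_def)
  qed
  then have "eps_vec n (replicate n False @ replicate n True) = of_nat (card {\<sigma>. \<sigma> permutes {..<n}})"
    by (simp add: eps_vec_def)
  then show ?thesis by (simp add: card_permutations)
qed

text \<open>\<open>D2_multiple\<close> applied to the non-zero invariant \<open>eps_vec n\<close>
  gives an invertible scalar, and inverting it makes \<open>dl n\<close> invariant too.\<close>

lemma D2_eq: "D2 n = {\<lambda>w. c * dl n w | c. True}"
proof -
  obtain c where c: "eps_vec n = (\<lambda>w. c * dl n w)"
    using D2_multiple[OF eps_vec_D2] by blast
  with eps_vec_nonzero[of n] have "c \<noteq> 0" by auto
  then have dl: "dl n = (\<lambda>w. inverse c * eps_vec n w)" by (simp add: c flip: mult.assoc)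
  have "dl n \<in> D2 n"
    unfolding dl by (intro D2_scale eps_vec_D2)
  then show ?thesis using D2_multiple D2_scale by blast
qed

section \<open>The spaces $E_m$\<close>

lemma subsp_tpow: "subsp (tpow n m)"
  by (cases m) (simp_all add: subsp_tens_space tensor_sp_def subsp_cspan)

lemma tensor_sp_tens_space:
  assumes "A \<subseteq> tens_space a" "B \<subseteq> tens_space b"
  shows "tensor_sp a A B \<subseteq> tens_space (a + b)"
  unfolding tensor_sp_def using assms
  by (intro cspan_minimal subsp_tens_space) (auto intro!: tens_tens_space)

lemma tpow_tens_space: "tpow n m \<subseteq> tens_space (n * m)"
proof (induction m)
  case (Suc m)
  have "Ln n \<subseteq> tens_space n" by (auto intro: Ln_tens_space)
  from tensor_sp_tens_space[OF this Suc] show ?case by simp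
qed simp

lemma tpow_Suc_iff:
  "x \<in> tpow n (Suc m) \<longleftrightarrow> (\<forall>i\<le>n. con n i x \<in> tpow n m) \<and> expand n x = x"
  by (simp add: tensor_Ln_iff[OF subsp_tpow])

lemma tens_e_tpow:
  assumes "i \<le> n" "y \<in> tpow n m"
  shows "tens n (e n i) y \<in> tpow n (Suc m)"
  using assms e_Ln[of i n] by (auto simp: tensor_sp_def intro!: cspan_superset)

lemma inner_e_tens:
  assumes "z \<in> tens_space (n + N)" "y \<in> tens_space N" "k \<le> n"
  shows "inner_v z (tens n (e n k) y) = inner_v (con n k z) y"
proof -
  have "tens n (e n k) y \<in> tens_space (n + N)"
    using assms by (intro tens_tens_space Ln_tens_space[OF e_Ln])
  then have "inner_v z (tens n (e n k) y) = cnj (inner_v (tens n (e n k) y) z)"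
    using assms(1) by (intro inner_commute)
  also have "\<dots> = cnj (inner_v y (con n k z))"
    by (simp only: inner_tens_e[OF assms(1,3)])
  also have "\<dots> = inner_v (con n k z) y"
    by (rule inner_commute[OF con_tens_space[OF assms(1)] assms(2), symmetric])
  finally show ?thesis .
qed

lemma orthogonal_tensor_iff:
  assumes "A \<subseteq> tens_space a" "B \<subseteq> tens_space b"
  shows "(\<forall>y\<in>tensor_sp a A B. inner_v x y = 0) \<longleftrightarrow> (\<forall>s\<in>A. \<forall>t\<in>B. inner_v x (tens a s t) = 0)"
proof -
  have "{tens a s t |s t. s \<in> A \<and> t \<in> B} \<subseteq> tens_space (a + b)"
    using assms by (auto intro!: tens_tens_space)
  from orthogonal_cspan_iff[OF this, of x] show ?thesis
    unfolding tensor_sp_def by blast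
qed

lemma tens_lincomb_right: "tens a s (\<lambda>w. \<Sum>i\<in>I. c i * y i w) = (\<lambda>w. \<Sum>i\<in>I. c i * tens a s (y i) w)"
  by (simp add: tens_def sum_distrib_left mult.left_commute)

lemma tens_lincomb_left: "tens a (\<lambda>w. \<Sum>i\<in>I. c i * y i w) s = (\<lambda>w. \<Sum>i\<in>I. c i * tens a (y i) s w)"
  by (simp add: tens_def sum_distrib_right mult.assoc)

lemma orthogonal_tens_tensor:
  assumes s: "s \<in> tens_space a" and B: "B \<subseteq> tens_space b" and C: "C \<subseteq> tens_space c"
    and orth: "\<And>p q. p \<in> B \<Longrightarrow> q \<in> C \<Longrightarrow> inner_v x (tens a s (tens b p q)) = 0"
    and t: "t \<in> tensor_sp b B C"
  shows "inner_v x (tens a s t) = 0"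
proof -
  from t obtain S r where S: "finite S" "S \<subseteq> {tens b p q |p q. p \<in> B \<and> q \<in> C}"
      "t = (\<lambda>w. \<Sum>y\<in>S. r y * y w)"
    unfolding tensor_sp_def cspan_def by auto
  have St: "tens a s y \<in> tens_space (a + (b + c)) \<and> inner_v x (tens a s y) = 0" if yS: "y \<in> S" for y
  proof -
    obtain p q where "y = tens b p q" "p \<in> B" "q \<in> C" using subsetD[OF S(2) yS] by auto
    then show ?thesis using B C s orth by (auto intro!: tens_tens_space)
  qed
  then show ?thesis
    unfolding S(3) tens_lincomb_right
    by (subst inner_sum_right[of _ _ "a + (b + c)"]) auto
qed

lemma D2_tens_space: "D2 n \<subseteq> tens_space (2 * n)"
  unfolding D2_eq using subsp_scale[OF subsp_tens_space dl_tens_space] by (auto simp: mult_2)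

lemma D2_tensor_tens_space: "tensor_sp (2 * n) (D2 n) (tpow n q) \<subseteq> tens_space (2 * n + n * q)"
  by (intro tensor_sp_tens_space D2_tens_space tpow_tens_space)

text \<open>Counting the factors to the left and right of D_2 by p = i - 1 and q = m - i - 1 removes
  the truncated subtractions.\<close>

lemma Ksp_eq:
  "Ksp n m = cspan (\<Union>{tensor_sp (n * p) (tpow n p) (tensor_sp (2 * n) (D2 n) (tpow n q)) |p q. p + q + 2 = m})"
  (is "_ = cspan (\<Union>{?Q p q |p q. _})")
proof -
  have "(\<Union>i\<in>{1..m-1}. ?Q (i - 1) (m - i - 1)) = \<Union>{?Q p q |p q. p + q + 2 = m}"
  proof (intro equalityI UN_least Union_least)
    fix i assume "i \<in> {1..m-1}"
    then have "(i - 1) + (m - i - 1) + 2 = m" by auto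
    then show "?Q (i - 1) (m - i - 1) \<subseteq> \<Union>{?Q p q |p q. p + q + 2 = m}" by blast
  next
    fix S assume "S \<in> {?Q p q |p q. p + q + 2 = m}"
    then obtain p q where pq: "S = ?Q p q" "p + q + 2 = m" by blast
    then have "p + 1 \<in> {1..m-1}" "p + 1 - 1 = p" "m - (p + 1) - 1 = q" by auto
    then show "S \<subseteq> (\<Union>i\<in>{1..m-1}. ?Q (i - 1) (m - i - 1))"
      unfolding pq(1) by (metis (no_types, lifting) UN_upper)
  qed
  then show ?thesis unfolding Ksp_def by simp
qed

lemma Ksp_summands_tens_space:
  "\<Union>{tensor_sp (n * p) (tpow n p) (tensor_sp (2 * n) (D2 n) (tpow n q)) |p q. p + q + 2 = m}
     \<subseteq> tens_space (n * m)"
proof (intro Union_least)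
  fix S assume "S \<in> {tensor_sp (n * p) (tpow n p) (tensor_sp (2 * n) (D2 n) (tpow n q)) |p q. p + q + 2 = m}"
  then obtain p q where S: "S = tensor_sp (n * p) (tpow n p) (tensor_sp (2 * n) (D2 n) (tpow n q))"
      "p + q + 2 = m" by blast
  have "n * p + (2 * n + n * q) = n * m" unfolding S(2)[symmetric] by (simp add: algebra_simps)
  then show "S \<subseteq> tens_space (n * m)"
    using tensor_sp_tens_space[OF tpow_tens_space[of n p] D2_tensor_tens_space[of n q]] by (simp add: S(1))
qed

lemma Ksp_tens_space: "Ksp n m \<subseteq> tens_space (n * m)"
  unfolding Ksp_eq by (intro cspan_minimal subsp_tens_space Ksp_summands_tens_space)

text \<open>Orthogonality to spans need only be tested on elementary tensors, and
  \<open>D2_eq\<close> leaves \<open>dl n\<close> as the only middle factor.\<close>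

lemma Esp_iff:
  "x \<in> Esp n m \<longleftrightarrow> x \<in> tpow n m \<and> (\<forall>p q. p + q + 2 = m \<longrightarrow>
     (\<forall>a\<in>tpow n p. \<forall>b\<in>tpow n q. inner_v x (tens (n * p) a (tens (2 * n) (dl n) b)) = 0))"
proof -
  let ?Q = "\<lambda>p q. tensor_sp (n * p) (tpow n p) (tensor_sp (2 * n) (D2 n) (tpow n q))"
  have "(\<forall>y\<in>Ksp n m. inner_v x y = 0) \<longleftrightarrow>
      (\<forall>y\<in>\<Union>{?Q p q |p q. p + q + 2 = m}. inner_v x y = 0)"
    unfolding Ksp_eq by (rule orthogonal_cspan_iff[OF Ksp_summands_tens_space])
  also have "\<dots> \<longleftrightarrow> (\<forall>p q. p + q + 2 = m \<longrightarrow> (\<forall>y\<in>?Q p q. inner_v x y = 0))" by blast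
  also have "\<dots> \<longleftrightarrow> (\<forall>p q. p + q + 2 = m \<longrightarrow>
     (\<forall>a\<in>tpow n p. \<forall>b\<in>tpow n q. inner_v x (tens (n * p) a (tens (2 * n) (dl n) b)) = 0))"
  proof -
    have "(\<forall>y\<in>?Q p q. inner_v x y = 0) \<longleftrightarrow>
       (\<forall>a\<in>tpow n p. \<forall>b\<in>tpow n q. inner_v x (tens (n * p) a (tens (2 * n) (dl n) b)) = 0)"
      (is "?L \<longleftrightarrow> ?R") for p q
    proof
      assume ?L
      then have *: "\<forall>a\<in>tpow n p. \<forall>t\<in>tensor_sp (2 * n) (D2 n) (tpow n q). inner_v x (tens (n * p) a t) = 0"
        using orthogonal_tensor_iff[OF tpow_tens_space D2_tensor_tens_space] by blast
      have "(\<lambda>w. 1 * dl n w) \<in> D2 n" unfolding D2_eq by blast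
      then have "tens (2 * n) (dl n) b \<in> tensor_sp (2 * n) (D2 n) (tpow n q)" if "b \<in> tpow n q" for b
        unfolding tensor_sp_def using that by (auto intro!: cspan_superset)
      with * show ?R by blast
    next
      assume R: ?R
      have "inner_v x (tens (n * p) a (tens (2 * n) g b)) = 0"
        if ab: "a \<in> tpow n p" "b \<in> tpow n q" and g: "g \<in> D2 n" for a b g
      proof -
        obtain c where c: "g = (\<lambda>w. c * dl n w)" using g unfolding D2_eq by blast
        have "tens (n * p) a (tens (2 * n) (dl n) b) \<in> tens_space (n * p + (2 * n + n * q))"
          using ab tpow_tens_space dl_tens_space[of n] by (auto simp: mult_2 intro!: tens_tens_space)
        moreover have "tens (n * p) a (tens (2 * n) g b) =
            (\<lambda>w. \<Sum>i\<in>{0::nat}. c * tens (n * p) a (tens (2 * n) (dl n) b) w)"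
          by (simp add: c tens_def mult_ac)
        ultimately show ?thesis
          using inner_sum_right[of "{0::nat}" "\<lambda>_. tens (n * p) a (tens (2 * n) (dl n) b)" _ x "\<lambda>_. c"] R ab
          by auto
      qed
      then have "\<forall>a\<in>tpow n p. \<forall>t\<in>tensor_sp (2 * n) (D2 n) (tpow n q). inner_v x (tens (n * p) a t) = 0"
        using orthogonal_tens_tensor[OF _ D2_tens_space tpow_tens_space] tpow_tens_space by blast
      then show ?L using orthogonal_tensor_iff[OF tpow_tens_space D2_tensor_tens_space] by blast
    qed
    then show ?thesis by simp
  qed
  finally show ?thesis by (simp add: Esp_def)
qed

lemma Esp_tpow: "Esp n m \<subseteq> tpow n m"
  by (auto simp: Esp_def)

lemma Esp_tens_space: "Esp n m \<subseteq> tens_space (n * m)"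
  using Esp_tpow tpow_tens_space by blast

lemma Esp_0: "Esp n 0 = tpow n 0"
  by (auto simp: Esp_iff)

lemma Esp_1: "Esp n (Suc 0) = tpow n (Suc 0)"
  by (auto simp only: Esp_iff)

lemma subsp_Esp: "subsp (Esp n m)"
proof -
  have K: "y \<in> tens_space (n * m)" if "y \<in> Ksp n m" for y
    using Ksp_tens_space that by blast
  have "x \<in> tpow n m" "y \<in> tpow n m \<Longrightarrow> (\<lambda>w. x w + y w) \<in> tpow n m"
    "(\<lambda>w. c * x w) \<in> tpow n m" if "x \<in> tpow n m" for x y c
    using subsp_tpow[of n m] that by (simp_all add: subsp_def)
  moreover have "(\<lambda>w. 0) \<in> tpow n m" using subsp_tpow[of n m] by (simp add: subsp_def)
  moreover have "inner_v (\<lambda>w. 0) y = 0" for y by (simp add: inner_v_def)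
  ultimately show ?thesis
    unfolding subsp_def Esp_def
    by (simp add: inner_add_left[OF K] inner_scale_left[OF K])
qed

section \<open>Contraction with delta and a recursive description of E_m\<close>

definition dcon :: "nat \<Rightarrow> vec \<Rightarrow> vec" where
  "dcon n x = (\<lambda>w. \<Sum>k\<le>n. (-1) ^ k * con n (n - k) (con n k x) w)"

lemma inner_dcon:
  assumes "x \<in> tens_space (n + (n + N))"
  shows "inner_v b (dcon n x) = (\<Sum>k\<le>n. (-1) ^ k * inner_v b (con n (n - k) (con n k x)))"
  unfolding dcon_def using assms
  by (subst inner_sum_right[of _ _ N]) (auto intro!: con_tens_space)

text \<open>Exhibits \<open>dcon\<close> as the adjoint of tensoring with \<open>dl n\<close> on the
  left: \<open>con n k\<close> removes the first factor of each summand,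
  \<open>con n (n - k)\<close> the second, and the signs are real.\<close>

lemma inner_dl_tens:
  assumes x: "x \<in> tens_space (n + (n + N))" and b: "b \<in> tens_space N"
  shows "inner_v x (tens (2 * n) (dl n) b) = inner_v (dcon n x) b"
proof -
  have "tens (2 * n) (dl n) b = (\<lambda>w. \<Sum>k\<le>n. (-1) ^ k * tens n (e n k) (tens n (e n (n - k)) b) w)"
    unfolding dl_def tens_lincomb_left mult_2 tens_assoc ..
  moreover have eb: "tens n (e n (n - k)) b \<in> tens_space (n + N)" for k
    using b by (intro tens_tens_space Ln_tens_space[OF e_Ln]) auto
  moreover have "tens n (e n k) (tens n (e n (n - k)) b) \<in> tens_space (n + (n + N))" if "k \<le> n" for k
    using that by (intro tens_tens_space Ln_tens_space[OF e_Ln] eb)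
  ultimately have "inner_v x (tens (2 * n) (dl n) b) =
     (\<Sum>k\<le>n. (-1) ^ k * inner_v x (tens n (e n k) (tens n (e n (n - k)) b)))"
    by (simp only:, subst inner_sum_right[of _ _ "n + (n + N)"]) auto
  also have "\<dots> = (\<Sum>k\<le>n. (-1) ^ k * inner_v (con n (n - k) (con n k x)) b)"
  proof (intro sum.cong refl)
    fix k assume "k \<in> {..n}"
    then have k: "k \<le> n" by simp
    show "(-1) ^ k * inner_v x (tens n (e n k) (tens n (e n (n - k)) b)) =
      (-1) ^ k * inner_v (con n (n - k) (con n k x)) b"
      using inner_e_tens[OF x _ k] inner_e_tens[OF con_tens_space[OF x] b, of "n - k" k] eb
      by simp
  qed
  also have "\<dots> = inner_v (dcon n x) b"
    unfolding dcon_def by (rule inner_sum_left[OF b, symmetric])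
  finally show ?thesis .
qed

lemma tens_dl_tens_space:
  assumes "a \<in> tpow n p" "b \<in> tpow n q"
  shows "tens (n * p) a (tens (2 * n) (dl n) b) \<in> tens_space (n * (p + q + 2))"
proof -
  have "a \<in> tens_space (n * p)" "b \<in> tens_space (n * q)" using assms tpow_tens_space by blast+
  then have "tens (n * p) a (tens (2 * n) (dl n) b) \<in> tens_space (n * p + (2 * n + n * q))"
    using dl_tens_space[of n] by (auto simp: mult_2 intro!: tens_tens_space)
  also have "n * p + (2 * n + n * q) = n * (p + q + 2)" by (simp add: algebra_simps)
  finally show ?thesis .
qed

text \<open>Passing to the adjoint prepends \<open>e n i\<close> to \<open>a\<close>, so the
  constraint on the contraction at \<open>p\<close> is the constraint on \<open>x\<close> at
  \<open>p + 1\<close>.\<close>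

lemma Esp_con:
  assumes x: "x \<in> Esp n (Suc m)" and i: "i \<le> n"
  shows "con n i x \<in> Esp n m"
  unfolding Esp_iff
proof (intro conjI allI impI ballI)
  have xt: "x \<in> tens_space (n + n * m)" using x Esp_tens_space[of n "Suc m"] by auto
  show "con n i x \<in> tpow n m" using x i Esp_tpow tpow_Suc_iff by blast
  fix p q a b assume pq: "p + q + 2 = m" and ab: "a \<in> tpow n p" "b \<in> tpow n q"
  have "inner_v (con n i x) (tens (n * p) a (tens (2 * n) (dl n) b)) =
      inner_v x (tens n (e n i) (tens (n * p) a (tens (2 * n) (dl n) b)))"
    using tens_dl_tens_space[OF ab] unfolding pq by (intro inner_e_tens[OF xt _ i, symmetric])
  also have "\<dots> = inner_v x (tens (n * Suc p) (tens n (e n i) a) (tens (2 * n) (dl n) b))"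
    by (simp add: tens_assoc)
  also have "\<dots> = 0"
  proof -
    have "Suc p + q + 2 = Suc m" using pq by simp
    then show ?thesis using x tens_e_tpow[OF i ab(1)] ab(2) unfolding Esp_iff by blast
  qed
  finally show "inner_v (con n i x) (tens (n * p) a (tens (2 * n) (dl n) b)) = 0" .
qed

lemma Esp_expand: "x \<in> Esp n (Suc m) \<Longrightarrow> expand n x = x"
  using Esp_tpow tpow_Suc_iff by blast

text \<open>\<open>dcon n x\<close> lies in the tensor power again, hence is an admissible right
  factor in the constraint at \<open>p = 0\<close>; this makes it orthogonal to itself.\<close>

lemma Esp_dcon:
  assumes x: "x \<in> Esp n (Suc (Suc m))"
  shows "dcon n x = (\<lambda>w. 0)"
proof -
  have xt: "x \<in> tens_space (n + (n + n * m))" using x Esp_tens_space[of n "Suc (Suc m)"] by auto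
  have "con n (n - k) (con n k x) \<in> tpow n m" if "k \<le> n" for k
    using Esp_con[OF Esp_con[OF x that], of "n - k"] Esp_tpow by auto
  then have d: "dcon n x \<in> tpow n m"
    unfolding dcon_def by (intro subsp_sum subsp_tpow) simp
  then have dt: "dcon n x \<in> tens_space (n * m)" using tpow_tens_space by blast
  \<comment> \<open>The unit of \<open>tpow n 0\<close>, serving as the empty left factor.\<close>
  let ?one = "\<lambda>w::bool list. if w = [] then 1 else 0 :: complex"
  have "?one \<in> tpow n 0" by (simp add: tens_space_def)
  moreover have "0 + m + 2 = Suc (Suc m)" by simp
  ultimately have "inner_v x (tens (n * 0) ?one (tens (2 * n) (dl n) (dcon n x))) = 0"
    using x d unfolding Esp_iff by blast
  moreover have "tens (n * 0) ?one y = y" for y by (simp add: tens_def)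
  ultimately have "inner_v (dcon n x) (dcon n x) = 0"
    by (simp add: inner_dl_tens[OF xt dt])
  then show ?thesis by (rule inner_self_eq_0[OF dt])
qed

text \<open>Converse to \<open>Esp_con\<close> and \<open>Esp_dcon\<close>: \<open>dc\<close> is the
  constraint on the first two factors, and all later constraints are inherited from the
  contractions.\<close>

lemma Esp_Suc_SucI:
  assumes con: "\<And>i. i \<le> n \<Longrightarrow> con n i x \<in> Esp n (Suc m)"
    and ex: "expand n x = x" and dc: "dcon n x = (\<lambda>w. 0)"
  shows "x \<in> Esp n (Suc (Suc m))"
  unfolding Esp_iff
proof (intro conjI allI impI ballI)
  show x: "x \<in> tpow n (Suc (Suc m))"
    unfolding tpow_Suc_iff[of x] using con ex Esp_tpow by blast
  then have xt: "x \<in> tens_space (n + (n + n * m))" using tpow_tens_space[of n "Suc (Suc m)"] by auto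
  fix p q a b assume pq: "p + q + 2 = Suc (Suc m)" and ab: "a \<in> tpow n p" "b \<in> tpow n q"
  let ?c = "tens (2 * n) (dl n) b"
  show "inner_v x (tens (n * p) a ?c) = 0"
  proof (cases p)
    case 0
    then have q: "q = m" using pq by simp
    have bt: "b \<in> tens_space (n * m)" using ab tpow_tens_space q by blast
    then have ct: "?c \<in> tens_space ((n + n) + n * m)"
      unfolding mult_2 by (intro tens_tens_space dl_tens_space)
    have "tens (n * p) a ?c = (\<lambda>w. a [] * ?c w)" using 0 by (simp add: tens_def)
    then show ?thesis
      using inner_scale_right[OF ct] inner_dl_tens[OF xt bt] dc by (simp add: inner_v_def)
  next
    case (Suc p')
    have a: "con n i a \<in> tpow n p'" "expand n a = a" if "i \<le> n" for i
      using ab(1) that unfolding Suc tpow_Suc_iff by blast+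
    \<comment> \<open>Expanding \<open>a\<close> along its first factor exposes an e_i, which moves
      over to \<open>x\<close> as a contraction.\<close>
    have "tens (n * p) a ?c = tens (n * p) (expand n a) ?c" using a(2)[of 0] by simp
    also have "\<dots> = tens (n * p) (\<lambda>w. \<Sum>i\<le>n. 1 * tens n (e n i) (con n i a) w) ?c"
      by (simp add: expand_def)
    also have "\<dots> = (\<lambda>w. \<Sum>i\<le>n. 1 * tens n (e n i) (tens (n * p') (con n i a) ?c) w)"
      unfolding tens_lincomb_left by (simp add: Suc tens_assoc)
    finally have ta: "tens (n * p) a ?c = (\<lambda>w. \<Sum>i\<le>n. 1 * tens n (e n i) (tens (n * p') (con n i a) ?c) w)" .
    have pq': "p' + q + 2 = Suc m" using pq Suc by simp
    have ct: "tens (n * p') (con n i a) ?c \<in> tens_space (n + n * m)" if "i \<le> n" for i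
      using tens_dl_tens_space[OF a(1)[OF that] ab(2)] unfolding pq' by simp
    have "inner_v x (tens (n * p) a ?c) =
        (\<Sum>i\<le>n. cnj 1 * inner_v x (tens n (e n i) (tens (n * p') (con n i a) ?c)))"
      unfolding ta by (intro inner_sum_right[of _ _ "n + (n + n * m)"] tens_tens_space Ln_tens_space[OF e_Ln] ct) auto
    also have "\<dots> = 0"
    proof (intro sum.neutral ballI)
      fix i assume "i \<in> {..n}"
      then have i: "i \<le> n" by simp
      have "inner_v x (tens n (e n i) (tens (n * p') (con n i a) ?c)) =
          inner_v (con n i x) (tens (n * p') (con n i a) ?c)"
        by (rule inner_e_tens[OF xt ct[OF i] i])
      also have "\<dots> = 0"
        using con[OF i] a(1)[OF i] ab(2) pq' unfolding Esp_iff by blast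
      finally show "cnj 1 * inner_v x (tens n (e n i) (tens (n * p') (con n i a) ?c)) = 0" by simp
    qed
    finally show ?thesis .
  qed
qed

section \<open>Creation operators\<close>

text \<open>Positivity and monotonicity need each other: d_{m+2} = n d_{m+1} + (d_{m+1} - d_m). For
  n = 0 the recursion gives d_2 = 0.\<close>

lemma d_mono_pos:
  assumes "n \<ge> 1"
  shows "0 < d n m \<and> d n m \<le> d n (Suc m)"
proof (induction m)
  case (Suc m)
  have "1 * d n (Suc m) \<le> real n * d n (Suc m)"
    using assms Suc by (intro mult_right_mono) auto
  moreover have "d n (Suc (Suc m)) = real n * d n (Suc m) + d n (Suc m) - d n m"
    by (simp add: distrib_right)
  ultimately show ?case using Suc by linarith
qed simp

lemma d_pos: "n \<ge> 1 \<Longrightarrow> 0 < d n m"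
  using d_mono_pos by blast

text \<open>Bounds the weights of the inverse of \<Phi>, so that it preserves
  square-summability.\<close>

lemma d_Suc_le: "n \<ge> 1 \<Longrightarrow> d n (Suc m) \<le> (real n + 1) * d n m"
  using d_pos[of n "m - 1"] by (cases m) auto

lemmas Esp_eqI = vec_eqI[OF subsp_Esp Esp_tens_space]

lemma con_lincomb: "con n i (\<lambda>w. a * x w - b * y w) = (\<lambda>w. a * con n i x w - b * con n i y w)"
  by (simp add: con_def sum_distrib_left right_diff_distrib sum_subtractf mult_ac)

lemma con_sum_tens_e:
  assumes "i \<le> n"
  shows "con n i (\<lambda>w. \<Sum>j\<le>n. tens n (e n j) (y j) w) = y i"
proof -
  have "con n i (\<lambda>w. \<Sum>j\<le>n. 1 * tens n (e n j) (y j) w) = (\<lambda>w. \<Sum>j\<le>n. 1 * con n i (tens n (e n j) (y j)) w)"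
    by (rule con_sum)
  also have "\<dots> = (\<lambda>w. \<Sum>j\<le>n. if i = j then y j w else 0)"
    using assms by (intro ext sum.cong refl) (simp add: con_tens_e)
  also have "\<dots> = y i" using assms by simp
  finally show ?thesis by simp
qed

lemma expand_sum_tens_e:
  "expand n (\<lambda>w. \<Sum>j\<le>n. tens n (e n j) (y j) w) = (\<lambda>w. \<Sum>j\<le>n. tens n (e n j) (y j) w)"
  unfolding expand_def by (intro ext sum.cong refl) (simp add: con_sum_tens_e)

lemma inner_sum_tens_e:
  assumes "z \<in> tens_space (n + N)"
  shows "inner_v (\<lambda>w. \<Sum>j\<le>n. tens n (e n j) (y j) w) z = (\<Sum>j\<le>n. inner_v (y j) (con n j z))"
  using inner_sum_left[OF assms, where I = "{..n}" and c = "\<lambda>_. 1" and x = "\<lambda>j. tens n (e n j) (y j)"]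
  by (simp add: inner_tens_e[OF assms])

text \<open>Parseval's identity in the first tensor factor, with the other factors as
  coefficients.\<close>

lemma inner_expand:
  assumes "x \<in> Esp n (Suc m)" "z \<in> tens_space (n + n * m)"
  shows "(\<Sum>i\<le>n. inner_v (con n i x) (con n i z)) = inner_v x z"
  using inner_sum_tens_e[OF assms(2), of "\<lambda>i. con n i x"] Esp_expand[OF assms(1)]
  by (simp add: expand_def)

section \<open>The creation operators on E_m, by induction on m\<close>

text \<open>The restriction of \<open>T_j\<close> to \<open>E_m\<close>.\<close>
definition cr :: "nat \<Rightarrow> nat \<Rightarrow> nat \<Rightarrow> vec \<Rightarrow> vec" where
  "cr n m j x = proj (Esp n (Suc m)) (tens n (e n j) x)"

text \<open>The properties of \<open>T_j\<close> on \<open>E_m\<close>, gathered into one predicate because they are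
  established by a simultaneous induction on \<open>m\<close>: membership, adjointness to the contraction,
  the relation for \<open>T_i\<^sup>* T_j\<close>, and the trace relation.\<close>
definition creates :: "nat \<Rightarrow> nat \<Rightarrow> bool" where
  "creates n m \<longleftrightarrow> (\<forall>x\<in>Esp n m.
     (\<forall>j\<le>n. cr n m j x \<in> Esp n (Suc m) \<and>
        (\<forall>z\<in>Esp n (Suc m). inner_v (cr n m j x) z = inner_v x (con n j z)) \<and>
        (\<forall>i\<le>n. con n i (cr n m j x) = (\<lambda>w. (if i = j then x w else 0) - (-1) ^ (i + j) *
           (case m of 0 \<Rightarrow> 0 | Suc k \<Rightarrow>
              of_real (d n k / d n m) * cr n k (n - i) (con n (n - j) x) w)))) \<and>
     (\<lambda>w. \<Sum>i\<le>n. con n i (cr n m i x) w) = (\<lambda>w. of_real (d n (Suc m) / d n m) * x w))"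

text \<open>By \<open>inner_tens_e\<close>, the assumption \<open>inner\<close> is the projection
  property in adjoint form; a guessed \<open>y\<close> only has to be paired with vectors of
  E_{m+1}.\<close>

lemma cr_eqI:
  assumes y: "y \<in> Esp n (Suc m)" and j: "j \<le> n"
    and inner: "\<And>z. z \<in> Esp n (Suc m) \<Longrightarrow> inner_v y z = inner_v x (con n j z)"
  shows "cr n m j x = y"
  unfolding cr_def
proof (rule proj_eqI[OF subsp_Esp Esp_tens_space y])
  fix z assume z: "z \<in> Esp n (Suc m)"
  then have zt: "z \<in> tens_space (n + n * m)" using Esp_tens_space[of n "Suc m"] by auto
  show "inner_v (\<lambda>w. tens n (e n j) x w - y w) z = 0"
    by (simp add: inner_diff_left[OF zt] inner_tens_e[OF zt j] inner[OF z])
qed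

text \<open>E_0 and E_1 carry no constraint, so e_j (x) x is its own projection. The value 0 in the
  \<open>case\<close> corresponds to d_{-1} = 0, and the trace is n + 1 = d_1/d_0.\<close>

lemma creates_0: "creates n 0"
proof -
  have y: "tens n (e n j) x \<in> Esp n (Suc 0)" if "x \<in> Esp n 0" "j \<le> n" for x j
    using tens_e_tpow[OF that(2)] that(1) unfolding Esp_0 Esp_1 by blast
  have inner: "inner_v (tens n (e n j) x) z = inner_v x (con n j z)"
    if "j \<le> n" "z \<in> Esp n (Suc 0)" for x j z
    using that Esp_tens_space[of n "Suc 0"] by (intro inner_tens_e[of _ _ 0]) auto
  have cr: "cr n 0 j x = tens n (e n j) x" if "x \<in> Esp n 0" "j \<le> n" for x j
    by (rule cr_eqI[OF y[OF that] that(2) inner[OF that(2)]])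
  show ?thesis
    unfolding creates_def by (simp add: cr y inner con_tens_e add.commute)
qed

lemma sum_flip:
  fixes f :: "nat \<Rightarrow> 'a::comm_monoid_add"
  shows "(\<Sum>k\<le>n. f (n - k)) = (\<Sum>k\<le>n. f k)"
  by (rule sum.reindex_bij_witness[of _ "\<lambda>k. n - k" "\<lambda>k. n - k"]) auto

lemma creates_Suc:
  assumes n: "n \<ge> 1" and IH: "creates n m"
  shows "creates n (Suc m)"
proof -
  have dpos: "d n m \<noteq> 0" "d n (Suc m) \<noteq> 0" using d_pos[OF n] by (metis less_irrefl)+
  \<comment> \<open>The inverse of the trace constant d_{m+1}/d_m at level \<open>m\<close>, as the
    cancellation in \<open>dcon\<close> requires.\<close>
  define r where "r = complex_of_real (d n m / d n (Suc m))"
  have crE: "cr n m j y \<in> Esp n (Suc m)" if "y \<in> Esp n m" "j \<le> n" for y j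
    using IH that unfolding creates_def by blast
  have crI: "inner_v (cr n m j y) z = inner_v y (con n j z)"
    if "y \<in> Esp n m" "j \<le> n" "z \<in> Esp n (Suc m)" for y j z
    using IH that unfolding creates_def by blast
  have crS: "(\<Sum>i\<le>n. con n i (cr n m i y) w) = of_real (d n (Suc m) / d n m) * y w"
    if "y \<in> Esp n m" for y w
    using IH that unfolding creates_def by metis
  \<comment> \<open>The components are those which the relation to be proved predicts for T_j x. As
    each lies in E_{m+1}, the delta-contraction is the only remaining condition for membership in
    E_{m+2}.\<close>
  define Y where "Y j x i = (\<lambda>w. (if i = j then 1 else 0) * x w -
      ((-1) ^ (i + j) * r) * cr n m (n - i) (con n (n - j) x) w)" for j x i
  have Y: "Y j x i \<in> Esp n (Suc m)" if "x \<in> Esp n (Suc m)" for j x i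
    unfolding Y_def using that
    by (intro subsp_diff subsp_scale subsp_Esp crE Esp_con[OF that]) auto
  define y where "y j x = (\<lambda>w. \<Sum>i\<le>n. tens n (e n i) (Y j x i) w)" for j x
  have con_y: "con n i (y j x) = Y j x i" if "i \<le> n" for i j x
    unfolding y_def by (rule con_sum_tens_e[OF that])
  have yE: "y j x \<in> Esp n (Suc (Suc m))" if x: "x \<in> Esp n (Suc m)" and j: "j \<le> n" for j x
  proof (rule Esp_Suc_SucI)
    show "expand n (y j x) = y j x" unfolding y_def by (rule expand_sum_tens_e)
    let ?t = "con n (n - j) x"
    have t: "?t \<in> Esp n m" using Esp_con[OF x, of "n - j"] by simp
    show "dcon n (y j x) = (\<lambda>w. 0)"
    proof
      fix w
      have "dcon n (y j x) w = (\<Sum>k\<le>n. (-1) ^ k * con n (n - k) (Y j x k) w)"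
        by (simp add: dcon_def con_y)
      \<comment> \<open>The sign (-1)^k cancels against the one in \<open>Y\<close>, so that after
        replacing k by n - k the correction is the trace at level \<open>m\<close>.\<close>
      also have "\<dots> = (\<Sum>k\<le>n. (if k = j then (-1) ^ j * ?t w else 0) -
          (-1) ^ j * r * con n (n - k) (cr n m (n - k) ?t) w)"
      proof (rule sum.cong[OF refl])
        fix k
        have "(-1) ^ k * ((-1) ^ (k + j) * a) = (-1) ^ j * a" for a :: complex
          by (simp add: power_add flip: mult.assoc power_mult_distrib)
        then show "(-1) ^ k * con n (n - k) (Y j x k) w = (if k = j then (-1) ^ j * ?t w else 0) -
            (-1) ^ j * r * con n (n - k) (cr n m (n - k) ?t) w"
          unfolding Y_def con_lincomb by (simp add: right_diff_distrib mult.assoc)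
      qed
      also have "\<dots> = (-1) ^ j * ?t w - (-1) ^ j * r * (\<Sum>k\<le>n. con n k (cr n m k ?t) w)"
        using j sum_flip[of "\<lambda>k. con n k (cr n m k ?t) w" n]
        by (simp add: sum_subtractf flip: sum_distrib_left)
      also have "\<dots> = (-1) ^ j * ?t w * (1 - r * of_real (d n (Suc m) / d n m))"
        unfolding crS[OF t] by (simp add: right_diff_distrib mult_ac)
      also have "r * of_real (d n (Suc m) / d n m) = 1"
        unfolding r_def of_real_mult[symmetric] using dpos by simp
      finally show "dcon n (y j x) w = 0" by simp
    qed
  qed (simp add: con_y Y[OF x])
  have yI: "inner_v (y j x) z = inner_v x (con n j z)"
    if x: "x \<in> Esp n (Suc m)" and j: "j \<le> n" and z: "z \<in> Esp n (Suc (Suc m))" for j x z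
  proof -
    let ?t = "con n (n - j) x"
    have t: "?t \<in> Esp n m" using Esp_con[OF x, of "n - j"] by simp
    have zt: "z \<in> tens_space (n + (n + n * m))" using z Esp_tens_space[of n "Suc (Suc m)"] by auto
    have cz: "con n i z \<in> Esp n (Suc m)" "con n i z \<in> tens_space (n + n * m)" if "i \<le> n" for i
      using Esp_con[OF z that] con_tens_space[OF zt] by auto
    have "inner_v (y j x) z = (\<Sum>i\<le>n. inner_v (Y j x i) (con n i z))"
      unfolding y_def by (rule inner_sum_tens_e[OF zt])
    also have "\<dots> = (\<Sum>i\<le>n. (if i = j then inner_v x (con n j z) else 0) -
        (-1) ^ j * r * ((-1) ^ i * inner_v ?t (con n (n - i) (con n i z))))"
    proof (rule sum.cong[OF refl])
      fix i assume "i \<in> {..n}"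
      then have i: "i \<le> n" by simp
      have "inner_v (Y j x i) (con n i z) = (if i = j then 1 else 0) * inner_v x (con n i z) -
          ((-1) ^ (i + j) * r) * inner_v (cr n m (n - i) ?t) (con n i z)"
        unfolding Y_def by (simp only: inner_diff_left[OF cz(2)[OF i]] inner_scale_left[OF cz(2)[OF i]])
      also have "inner_v (cr n m (n - i) ?t) (con n i z) = inner_v ?t (con n (n - i) (con n i z))"
        by (rule crI[OF t _ cz(1)[OF i]]) simp
      finally show "inner_v (Y j x i) (con n i z) = (if i = j then inner_v x (con n j z) else 0) -
        (-1) ^ j * r * ((-1) ^ i * inner_v ?t (con n (n - i) (con n i z)))"
        by (simp add: power_add mult_ac)
    qed
    \<comment> \<open>The corrections assemble into \<open>dcon n z\<close>, which vanishes because
      \<open>z\<close> lies in E_{m+2}.\<close>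
    also have "\<dots> = inner_v x (con n j z) - (-1) ^ j * r * inner_v ?t (dcon n z)"
      unfolding inner_dcon[OF zt] using j by (simp add: sum_subtractf flip: sum_distrib_left)
    also have "inner_v ?t (dcon n z) = 0"
      unfolding Esp_dcon[OF z] by (simp add: inner_v_def)
    finally show ?thesis by simp
  qed
  have cr: "cr n (Suc m) j x = y j x" if "x \<in> Esp n (Suc m)" "j \<le> n" for j x
    by (rule cr_eqI[OF yE[OF that] that(2) yI[OF that]])
  have tr: "(\<Sum>i\<le>n. con n i (y i x) w) = of_real (d n (Suc (Suc m)) / d n (Suc m)) * x w"
    if x: "x \<in> Esp n (Suc m)" for x w
  proof -
    have cx: "con n i x \<in> Esp n m" if "i \<le> n" for i using Esp_con[OF x that] .
    \<comment> \<open>Tested against \<open>z\<close>, each creation operator becomes a contraction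
      and the identity becomes \<open>inner_expand\<close>.\<close>
    have "(\<lambda>w. \<Sum>i\<le>n. 1 * cr n m i (con n i x) w) = x"
    proof (rule Esp_eqI[OF _ x])
      show "(\<lambda>w. \<Sum>i\<le>n. 1 * cr n m i (con n i x) w) \<in> Esp n (Suc m)"
        by (intro subsp_sum subsp_Esp crE cx) auto
      fix z assume z: "z \<in> Esp n (Suc m)"
      then have zt: "z \<in> tens_space (n + n * m)" using Esp_tens_space[of n "Suc m"] by auto
      have "inner_v (\<lambda>w. \<Sum>i\<le>n. 1 * cr n m i (con n i x) w) z =
          (\<Sum>i\<le>n. 1 * inner_v (cr n m i (con n i x)) z)"
        by (rule inner_sum_left[OF zt])
      also have "\<dots> = (\<Sum>i\<le>n. inner_v (con n i x) (con n i z))"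
        by (intro sum.cong refl) (simp add: crI[OF cx _ z])
      also have "\<dots> = inner_v x z" by (rule inner_expand[OF x zt])
      finally show "inner_v (\<lambda>w. \<Sum>i\<le>n. 1 * cr n m i (con n i x) w) z = inner_v x z" .
    qed
    then have s: "(\<Sum>i\<le>n. cr n m i (con n i x) w) = x w" by (simp add: fun_eq_iff)
    \<comment> \<open>On the diagonal the sign is (-1)^(2 i) = 1; there are n + 1 copies of
      \<open>x\<close>, and the corrections sum to \<open>r\<close> times \<open>x\<close> by
      \<open>s\<close>.\<close>
    have "(\<Sum>i\<le>n. con n i (y i x) w) = (\<Sum>i\<le>n. x w - r * cr n m (n - i) (con n (n - i) x) w)"
      by (intro sum.cong refl) (simp add: con_y Y_def flip: mult_2 power_add)
    also have "\<dots> = (of_nat n + 1) * x w - r * x w"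
      using sum_flip[of "\<lambda>i. cr n m i (con n i x) w" n]
      by (simp add: sum_subtractf s flip: sum_distrib_left)
    also have "\<dots> = (of_nat n + 1 - r) * x w" by (simp add: left_diff_distrib)
    also have "of_nat n + 1 - r = complex_of_real (real n + 1 - d n m / d n (Suc m))"
      by (simp add: r_def)
    also have "real n + 1 - d n m / d n (Suc m) = d n (Suc (Suc m)) / d n (Suc m)"
      using dpos by (simp add: diff_divide_distrib)
    finally show ?thesis .
  qed
  have "con n i (y j x) = (\<lambda>w. (if i = j then x w else 0) - (-1) ^ (i + j) *
           (of_real (d n m / d n (Suc m)) * cr n m (n - i) (con n (n - j) x) w))"
    if "i \<le> n" for i j x
    unfolding con_y[OF that] Y_def r_def by (auto simp: mult.assoc)
  then show ?thesis
    unfolding creates_def using yE yI tr by (simp add: cr del: d.simps)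
qed

lemma creates: "n \<ge> 1 \<Longrightarrow> creates n m"
  by (induction m) (simp_all add: creates_0 creates_Suc)

section \<open>Norm bounds and vectors of the Fock space\<close>

lemma Esp_zero: "(\<lambda>w. 0) \<in> Esp n m"
  using subsp_Esp[of n m] by (simp add: subsp_def)

lemma nsq_con_le:
  assumes x: "x \<in> Esp n (Suc m)" and j: "j \<le> n"
  shows "nsq (con n j x) \<le> nsq x"
proof -
  have xt: "x \<in> tens_space (n + n * m)" using x Esp_tens_space[of n "Suc m"] by auto
  have "nsq x = (\<Sum>i\<le>n. nsq (con n i x))"
    unfolding nsq_def by (simp flip: inner_expand[OF x xt])
  moreover have "nsq (con n j x) \<le> (\<Sum>i\<le>n. nsq (con n i x))"
    using j by (intro member_le_sum nsq_nonneg[OF con_tens_space[OF xt]]) auto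
  ultimately show ?thesis by simp
qed

lemma nsq_zero: "nsq (\<lambda>w. 0) = 0"
  by (simp add: nsq_def inner_v_def)

lemma nsq_scale: "x \<in> tens_space N \<Longrightarrow> nsq (\<lambda>w. c * x w) = (cmod c)\<^sup>2 * nsq x"
  using subsp_scale[OF subsp_tens_space, of x N c]
  by (simp add: nsq_words norm_mult power_mult_distrib sum_distrib_left)

lemma Fock_iff: "v \<in> Fock n \<longleftrightarrow> (\<forall>m. v m \<in> Esp n m) \<and> summable (\<lambda>m. nsq (v m))"
  by (simp add: Fock_def nsq_def)

lemma nsq_Esp_nonneg: "x \<in> Esp n m \<Longrightarrow> 0 \<le> nsq x"
  using Esp_tens_space nsq_nonneg by blast

lemma FockI:
  assumes "\<And>m. u m \<in> Esp n m" "summable f" "\<And>m. nsq (u m) \<le> f m"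
  shows "u \<in> Fock n"
proof -
  have "norm (nsq (u m)) \<le> f m" for m
    using nsq_Esp_nonneg[OF assms(1)[of m]] assms(3)[of m] by simp
  then have "summable (\<lambda>m. nsq (u m))"
    by (intro summable_comparison_test'[OF assms(2), of 0])
  with assms(1) show ?thesis by (simp add: Fock_iff)
qed

lemma T_eq: "T n j v = (\<lambda>m. case m of 0 \<Rightarrow> (\<lambda>w. 0) | Suc k \<Rightarrow> cr n k j (v k))"
  by (simp add: T_def creation_def cr_def cong: nat.case_cong)

lemma con_Fock:
  assumes v: "v \<in> Fock n" and j: "j \<le> n"
  shows "(\<lambda>m. con n j (v (Suc m))) \<in> Fock n"
proof (rule FockI)
  have vE: "v m \<in> Esp n m" for m using v by (simp add: Fock_iff)
  show "con n j (v (Suc m)) \<in> Esp n m" for m by (rule Esp_con[OF vE j])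
  show "summable (\<lambda>m. nsq (v (Suc m)))"
    using v by (subst summable_Suc_iff) (simp add: Fock_iff)
  show "nsq (con n j (v (Suc m))) \<le> nsq (v (Suc m))" for m by (rule nsq_con_le[OF vE j])
qed

text \<open>Test vectors concentrated in one degree reduce the series \<open>innerF\<close> to a
  single term.\<close>

lemma Fock_eqI:
  assumes u: "u \<in> Fock n" and v: "v \<in> Fock n"
    and inner: "\<And>z. z \<in> Fock n \<Longrightarrow> innerF u z = innerF v z"
  shows "u = v"
proof
  fix m
  show "u m = v m"
  proof (rule Esp_eqI)
    show "u m \<in> Esp n m" "v m \<in> Esp n m" using u v by (simp_all add: Fock_iff)
    fix x assume x: "x \<in> Esp n m"
    let ?z = "\<lambda>k. if k = m then x else (\<lambda>w. 0)"
    have 0: "nsq (\<lambda>w. 0) = 0" "inner_v y (\<lambda>w. 0) = 0" for y by (simp_all add: nsq_def inner_v_def)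
    have "summable (\<lambda>k. nsq (?z k))"
      by (rule summable_finite[of "{m}"]) (simp_all add: 0)
    then have "?z \<in> Fock n" using x by (simp add: Fock_iff Esp_zero)
    moreover have "innerF y ?z = inner_v (y m) x" for y
    proof -
      have "innerF y ?z = (\<Sum>k\<in>{m}. inner_v (y k) (?z k))"
        unfolding innerF_def by (rule suminf_finite) (simp_all add: 0)
      then show ?thesis by simp
    qed
    ultimately show "inner_v (u m) x = inner_v (v m) x" using inner by metis
  qed
qed

section \<open>The operators on F for n at least 1: relations, adjoints and the inverse of
  \<Phi>\<close>

context
  fixes n :: nat
  assumes n: "n \<ge> 1"
begin

lemma cr_Esp: "x \<in> Esp n m \<Longrightarrow> j \<le> n \<Longrightarrow> cr n m j x \<in> Esp n (Suc m)"
  using creates[OF n, of m] unfolding creates_def by blast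

lemma inner_cr:
  "x \<in> Esp n m \<Longrightarrow> j \<le> n \<Longrightarrow> z \<in> Esp n (Suc m) \<Longrightarrow> inner_v (cr n m j x) z = inner_v x (con n j z)"
  using creates[OF n, of m] unfolding creates_def by blast

lemma con_cr:
  "x \<in> Esp n m \<Longrightarrow> i \<le> n \<Longrightarrow> j \<le> n \<Longrightarrow>
   con n i (cr n m j x) = (\<lambda>w. (if i = j then x w else 0) - (-1) ^ (i + j) *
     (case m of 0 \<Rightarrow> 0 | Suc k \<Rightarrow> of_real (d n k / d n m) * cr n k (n - i) (con n (n - j) x) w))"
  using creates[OF n, of m] unfolding creates_def by blast

lemma sum_con_cr:
  "x \<in> Esp n m \<Longrightarrow> (\<Sum>i\<le>n. con n i (cr n m i x) w) = of_real (d n (Suc m) / d n m) * x w"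
  using creates[OF n, of m] unfolding creates_def by metis

text \<open>Needed in degree 1 of T_i T_{n-i} v, where T_i acts on the zero component of T_{n-i} v
  in degree 0.\<close>

lemma cr_zero:
  assumes "j \<le> n"
  shows "cr n m j (\<lambda>w. 0) = (\<lambda>w. 0)"
  by (rule cr_eqI[OF Esp_zero assms]) (simp add: inner_v_def)

text \<open>Adjoint form of \<open>Esp_dcon\<close>: paired with \<open>z\<close>, the two creation
  operators become contractions in reversed order, whose sum is \<open>dcon n z\<close>.\<close>

lemma sum_cr_cr:
  assumes x: "x \<in> Esp n m"
  shows "(\<lambda>w. \<Sum>i\<le>n. (-1) ^ i * cr n (Suc m) i (cr n m (n - i) x) w) = (\<lambda>w. 0)"
proof (rule Esp_eqI[OF _ Esp_zero])
  show "(\<lambda>w. \<Sum>i\<le>n. (-1) ^ i * cr n (Suc m) i (cr n m (n - i) x) w) \<in> Esp n (Suc (Suc m))"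
    by (intro subsp_sum subsp_Esp cr_Esp x) auto
  fix z assume z: "z \<in> Esp n (Suc (Suc m))"
  then have zt: "z \<in> tens_space (n + (n + n * m))" using Esp_tens_space[of n "Suc (Suc m)"] by auto
  have "inner_v (\<lambda>w. \<Sum>i\<le>n. (-1) ^ i * cr n (Suc m) i (cr n m (n - i) x) w) z =
      (\<Sum>i\<le>n. (-1) ^ i * inner_v (cr n (Suc m) i (cr n m (n - i) x)) z)"
    by (rule inner_sum_left[OF zt])
  also have "\<dots> = (\<Sum>i\<le>n. (-1) ^ i * inner_v x (con n (n - i) (con n i z)))"
    by (intro sum.cong refl) (simp add: inner_cr cr_Esp x z Esp_con)
  also have "\<dots> = inner_v x (dcon n z)" by (rule inner_dcon[OF zt, symmetric])
  finally show "inner_v (\<lambda>w. \<Sum>i\<le>n. (-1) ^ i * cr n (Suc m) i (cr n m (n - i) x) w) z = inner_v (\<lambda>w. 0) z"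
    by (simp add: Esp_dcon[OF z] inner_v_def)
qed

text \<open>For y = T_j x, |y|^2 = Re <x, c_j y> is at most (|x|^2 + |y|^2)/2, and the second term
  is absorbed on the left.\<close>

lemma nsq_cr_le:
  assumes x: "x \<in> Esp n m" and j: "j \<le> n"
  shows "nsq (cr n m j x) \<le> nsq x"
proof -
  let ?y = "cr n m j x"
  have y: "?y \<in> Esp n (Suc m)" by (rule cr_Esp[OF x j])
  have "nsq ?y = Re (inner_v x (con n j ?y))"
    by (simp only: nsq_def inner_cr[OF x j y])
  also have "\<dots> \<le> (nsq x + nsq (con n j ?y)) / 2"
    using x Esp_con[OF y j] Esp_tens_space[of n m] by (intro Re_inner_le) auto
  finally show ?thesis using nsq_con_le[OF y j] by simp
qed

lemma T_Fock:
  assumes v: "v \<in> Fock n" and j: "j \<le> n"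
  shows "T n j v \<in> Fock n"
proof (rule FockI)
  have vE: "v m \<in> Esp n m" for m using v by (simp add: Fock_iff)
  show "T n j v m \<in> Esp n m" for m
    by (cases m) (simp_all add: T_eq Esp_zero cr_Esp vE j)
  show "summable (\<lambda>m. case m of 0 \<Rightarrow> 0 | Suc k \<Rightarrow> nsq (v k))"
    using v by (subst summable_Suc_iff[symmetric]) (simp add: Fock_iff)
  show "nsq (T n j v m) \<le> (case m of 0 \<Rightarrow> 0 | Suc k \<Rightarrow> nsq (v k))" for m
    by (cases m) (simp_all add: T_eq nsq_cr_le vE j nsq_zero)
qed

lemma adjF_T:
  assumes v: "v \<in> Fock n" and j: "j \<le> n"
  shows "adjF n (T n j) v = (\<lambda>m. con n j (v (Suc m)))"
proof -
  let ?a = "\<lambda>m. con n j (v (Suc m))"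
  have vE: "v m \<in> Esp n m" for m using v by (simp add: Fock_iff)
  have ad: "innerF ?a z = innerF v (T n j z)" if z: "z \<in> Fock n" for z
  proof -
    have zE: "z m \<in> Esp n m" for m using z by (simp add: Fock_iff)
    have t: "inner_v (v (Suc m)) (T n j z (Suc m)) = inner_v (?a m) (z m)" for m
    proof -
      have "inner_v (v (Suc m)) (cr n m j (z m)) = cnj (inner_v (cr n m j (z m)) (v (Suc m)))"
        using vE[of "Suc m"] cr_Esp[OF zE j] Esp_tens_space by (intro inner_commute) blast+
      also have "\<dots> = cnj (inner_v (z m) (?a m))" by (simp only: inner_cr[OF zE j vE])
      also have "\<dots> = inner_v (?a m) (z m)"
        using zE[of m] Esp_con[OF vE j] Esp_tens_space by (intro inner_commute[symmetric]) blast+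
      finally show ?thesis by (simp add: T_eq)
    qed
    have "inner_v (v 0) (T n j z 0) = 0" by (simp add: T_eq inner_v_def)
    \<comment> \<open>\<open>suminf\<close> is a description over \<open>sums\<close>, so equality
      of the two \<open>sums\<close> predicates suffices without any convergence proof. The shift
      costs nothing because T_j z vanishes in degree 0.\<close>
    then have "(\<lambda>m. inner_v (?a m) (z m)) sums s \<longleftrightarrow> (\<lambda>m. inner_v (v m) (T n j z m)) sums s" for s
      using sums_Suc_iff[of "\<lambda>m. inner_v (v m) (T n j z m)" s] by (simp only: t) simp
    then have "(sums) (\<lambda>m. inner_v (?a m) (z m)) = (sums) (\<lambda>m. inner_v (v m) (T n j z m))"
      by (rule ext)
    then show ?thesis unfolding innerF_def suminf_def by (rule arg_cong)
  qed
  show ?thesis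
    unfolding adjF_def
  proof (rule the_equality)
    show "?a \<in> Fock n \<and> (\<forall>z\<in>Fock n. innerF ?a z = innerF v (T n j z))"
      using con_Fock[OF v j] ad by blast
    fix u assume "u \<in> Fock n \<and> (\<forall>z\<in>Fock n. innerF u z = innerF v (T n j z))"
    then show "u = ?a" using con_Fock[OF v j] ad by (intro Fock_eqI) auto
  qed
qed

lemma Phi_inv_eq:
  assumes v: "v \<in> Fock n"
  shows "Phi_inv n v = (\<lambda>m w. of_real (d n (Suc m) / d n m) * v m w)"
proof -
  have d0: "d n m \<noteq> 0" for m using d_pos[OF n, of m] by simp
  let ?u = "\<lambda>m w. complex_of_real (d n (Suc m) / d n m) * v m w"
  have vE: "v m \<in> Esp n m" for m using v by (simp add: Fock_iff)
  have "?u \<in> Fock n"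
  proof (rule FockI)
    show "?u m \<in> Esp n m" for m by (intro subsp_scale subsp_Esp vE)
    show "summable (\<lambda>m. (real n + 1)\<^sup>2 * nsq (v m))"
      using v by (intro summable_mult) (simp add: Fock_iff)
    fix m
    have vt: "v m \<in> tens_space (n * m)" using vE Esp_tens_space by blast
    have "nsq (?u m) = (d n (Suc m) / d n m)\<^sup>2 * nsq (v m)"
      by (simp only: nsq_scale[OF vt] norm_of_real power2_abs)
    also have "\<dots> \<le> (real n + 1)\<^sup>2 * nsq (v m)"
      using d_Suc_le[OF n, of m] d_pos[OF n, of m] d_pos[OF n, of "Suc m"] nsq_nonneg[OF vt]
      by (intro mult_right_mono power_mono) (auto simp: divide_le_eq simp del: d.simps)
    finally show "nsq (?u m) \<le> (real n + 1)\<^sup>2 * nsq (v m)" .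
  qed
  moreover have "Phi n ?u = v"
    using d0 by (simp add: Phi_def del: d.simps)
  moreover have "u = ?u" if "Phi n u = v" for u
    unfolding that[symmetric] using d0 by (simp add: Phi_def del: d.simps)
  ultimately show ?thesis
    unfolding Phi_inv_def by (intro the_equality) blast+
qed

end

theorem theorem4p6:
  fixes n :: nat
  assumes "n \<ge> 1"
  shows "(\<forall>v\<in>Fock n. (\<lambda>m w. \<Sum>i\<le>n. (-1) ^ i * T n i (T n (n - i) v) m w) = (\<lambda>m w. 0))
    \<and> (\<forall>i\<le>n. \<forall>j\<le>n. \<forall>v\<in>Fock n.
         adjF n (T n i) (T n j v) =
           (\<lambda>m w. (if i = j then v m w else 0)
              + (-1) ^ (i + j + 1) *
                  (of_nat (n + 1) * T n (n - i) (adjF n (T n (n - j)) v) m w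
                   - Phi_inv n (T n (n - i) (adjF n (T n (n - j)) v)) m w)))
    \<and> (\<forall>v\<in>Fock n. (\<lambda>m w. \<Sum>i\<le>n. adjF n (T n i) (T n i v) m w) = Phi_inv n v)"
proof (intro conjI ballI allI impI)
  note n = \<open>n \<ge> 1\<close>
  fix v assume v: "v \<in> Fock n"
  then have vE: "v m \<in> Esp n m" for m by (simp add: Fock_iff)
  show "(\<lambda>m w. \<Sum>i\<le>n. (-1) ^ i * T n i (T n (n - i) v) m w) = (\<lambda>m w. 0)"
  proof
    fix m
    show "(\<lambda>w. \<Sum>i\<le>n. (-1) ^ i * T n i (T n (n - i) v) m w) = (\<lambda>w. 0)"
    proof (cases m)
      case (Suc k)
      then show ?thesis
        using sum_cr_cr[OF n vE] by (cases k) (simp_all add: T_eq cr_zero[OF n])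
    qed (simp add: T_eq)
  qed
  show "(\<lambda>m w. \<Sum>i\<le>n. adjF n (T n i) (T n i v) m w) = Phi_inv n v"
    unfolding Phi_inv_eq[OF n v]
  proof (intro ext)
    fix m w
    have "adjF n (T n i) (T n i v) m = con n i (cr n m i (v m))" if "i \<le> n" for i
    proof -
      have "adjF n (T n i) (T n i v) m = con n i (T n i v (Suc m))"
        by (simp only: adjF_T[OF n T_Fock[OF n v that] that])
      then show ?thesis by (simp add: T_eq)
    qed
    then have "(\<Sum>i\<le>n. adjF n (T n i) (T n i v) m w) = (\<Sum>i\<le>n. con n i (cr n m i (v m)) w)"
      by simp
    then show "(\<Sum>i\<le>n. adjF n (T n i) (T n i v) m w) = of_real (d n (Suc m) / d n m) * v m w"
      by (simp only: sum_con_cr[OF n vE])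
  qed
next
  note n = \<open>n \<ge> 1\<close>
  fix i j v assume ij: "i \<le> n" "j \<le> n" and v: "v \<in> Fock n"
  then have vE: "v m \<in> Esp n m" for m by (simp add: Fock_iff)
  let ?a = "\<lambda>m. con n (n - j) (v (Suc m))"
  have a: "adjF n (T n (n - j)) v = ?a" by (rule adjF_T[OF n v]) simp
  have aF: "T n (n - i) ?a \<in> Fock n"
    by (intro T_Fock[OF n] con_Fock[OF v]) auto
  show "adjF n (T n i) (T n j v) =
           (\<lambda>m w. (if i = j then v m w else 0)
              + (-1) ^ (i + j + 1) *
                  (of_nat (n + 1) * T n (n - i) (adjF n (T n (n - j)) v) m w
                   - Phi_inv n (T n (n - i) (adjF n (T n (n - j)) v)) m w))"
    unfolding a Phi_inv_eq[OF n aF] adjF_T[OF n T_Fock[OF n v ij(2)] ij(1)]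
  proof (intro ext)
    fix m w
    let ?X = "T n (n - i) ?a m w"
    have "con n i (T n j v (Suc m)) w = con n i (cr n m j (v m)) w" by (simp add: T_eq)
    also have "\<dots> = (if i = j then v m w else 0) - (-1) ^ (i + j) *
        (of_nat (n + 1) * ?X - of_real (d n (Suc m) / d n m) * ?X)"
    proof (cases m)
      \<comment> \<open>A vector in the range of a creation operator has no component in degree 0,
        so \<open>?X\<close> is 0, in agreement with the \<open>case\<close> in
        \<open>con_cr\<close>.\<close>
      case 0
      then show ?thesis by (simp add: con_cr[OF n vE ij] T_eq)
    next
      case (Suc k)
      have "d n m \<noteq> 0" using d_pos[OF n, of m] by simp
      \<comment> \<open>The recursion identifies the factor in \<open>con_cr\<close> with the scalar
        by which (n + 1) 1 minus the inverse of \<Phi> acts in degree \<open>m\<close>.\<close>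
      then have "real n + 1 - d n (Suc m) / d n m = d n k / d n m"
        by (simp add: Suc diff_divide_distrib)
      then have "complex_of_real (real n + 1 - d n (Suc m) / d n m) = of_real (d n k / d n m)"
        by (simp only:)
      then have "of_nat (n + 1) * ?X - of_real (d n (Suc m) / d n m) * ?X = of_real (d n k / d n m) * ?X"
        by (simp add: algebra_simps del: d.simps)
      moreover have "?X = cr n k (n - i) (con n (n - j) (v m)) w" by (simp add: T_eq Suc)
      ultimately show ?thesis by (simp add: con_cr[OF n vE ij] Suc del: d.simps)
    qed
    finally show "con n i (T n j v (Suc m)) w = (if i = j then v m w else 0) + (-1) ^ (i + j + 1) *
        (of_nat (n + 1) * ?X - of_real (d n (Suc m) / d n m) * ?X)"
      by simp
  qed
qed

end
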